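(* Let $X$, $A$, $\mathcal{U}$, $u\mapsto B^u$, $\gamma$, $L$, the ergodic cost $J(x,U)$, and the Hamiltonian $$f(x,z)=\inf_{u\in\mathcal{U}}\big\{L(x,u)+z^*(B^u-A)x\big\},\qquad x\in\mathcal{X},\ z\in\mathbb{R}^N,$$ be as described in the context, and let $(\bar Y,\bar Z,\bar\lambda)$ be a bounded, stationary, Markovian solution of the Ergodic BSDE with driver $f$ (which exists). Let $(Y,Z,\lambda)$ be any (possibly non-Markovian) bounded solution of the Ergodic BSDE with driver $f$, i.e. a.s. for all $0\le t<T<\infty$ $$Y_T=Y_t-\sum_{t\le u<T}\big(f(X_u,Z_u)-\lambda\big)+\sum_{t\le u<T}Z_u^{*}M_{u+1}.$$ Then the following hold (for $x\in\mathcal{X}$): 1. For any control $U$, $J(x,U)\ge\lambda=\bar\lambda$, with equality if $$f(X_s,Z_s)=L(X_s,U_s)+Z_s^{*}(B^{U_s}-A)X_s\quad\text{for all } s\ge0.$$ 2. If the infimum defining $f$ is attained, and $\kappa:\mathcal{X}\times\mathbb{R}^N\to\mathcal{U}$ is a measurable function (one exists) such that $f(x',z)=L(x',\kappa(x',z))+z^*(B^{\kappa(x',z)}-A)x'$ for all $(x',z)\in\mathcal{X}\times\mathbb{R}^N$, then the control $\bar U_t=\kappa(X_t,Z_t)$ satisfies $J(x,\bar U)=\bar\lambda$. 3. Even if the infimum defining $f$ is not attained, there still exists a control $\hat U$ such that $J(x,\hat U)=\bar\lambda$.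
   Context: Setting. $\mathcal{X}=\{e_1,\dots,e_N\}$ is the standard basis of $\mathbb{R}^N$ (column vectors; $*$ is transposition), $X=(X_t)_{t\ge0}$ is an $\mathcal{X}$-valued process in discrete time $t\in\{0,1,2,\dots\}$ on a probability space $(\Omega,\mathcal{F},\mathbb{P})$, $\mathcal{F}_t$ is the $\mathbb{P}$-completion of $\sigma(X_0,\dots,X_t)$ (adding only subsets of null sets of $\sigma(X_0,\dots,X_t)$), and $\mathcal{F}=\sigma(\bigcup_t\mathcal{F}_t)$. Adapted means $\mathcal{F}_t$-measurable at each time $t$. Transition matrices are column-stochastic ($(i,j)$ entry = probability of jumping from $e_j$ to $e_i$). Assumptions. - Under $\mathbb{P}$, $X$ is a time-homogeneous Markov chain with transition matrix $A$ which is uniformly ergodic: there are a probability measure $\pi$ on $\mathcal{X}$ and $R,\rho>0$ with $\sup_\mu\|P_t\mu-\pi\|_{TV}\le Re^{-\rho t}$ for all $t\ge0$ (supremum over probability measures $\mu$ on $\mathcal{X}$, $P_t\mu$ = law of $X_t$ given $X_0\sim\mu$, $\|\mu\|_{TV}=\frac12\sum_x|\mu(\{x\})|$). $M_{t+1}:=X_{t+1}-AX_t$. - $\mathcal{U}$ is a topological space equal to a countable union of compact metrizable subsets of itself. - $u\mapsto B^u$ is a continuous map from $\mathcal{U}$ to transition matrices, and for a fixed $\gamma\in(0,1)$ one has $B^u\sim_\gamma A$ for all $u$, meaning $B^u\ge\gamma A$ and $A\ge\gamma B^u$ componentwise. - $L:\mathcal{X}\times\mathcal{U}\to\mathbb{R}$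 is bounded, measurable in $x$ and continuous in $u$. A control $U$ is a $\mathcal{U}$-valued adapted process. $\mathbb{E}^U_x$ is the expectation under which $X_0=x$ and, for any given pair $(\omega,t)$, $X$ jumps according to the transition matrix $B^{U_t(\omega)}$, i.e. the conditional probability of $X_{t+1}=e_i$ given $\mathcal{F}_t$ is $e_i^*B^{U_t}X_t$. The ergodic cost is $$J(x,U)=\limsup_{T\to\infty}\frac1T\,\mathbb{E}^U_x\Big[\sum_{0\le s<T}L(X_s,U_s)\Big].$$ A solution of the Ergodic BSDE is a triple $(Y,Z,\lambda)$ with $Y$ (real-valued) and $Z$ ($\mathbb{R}^N$-valued) adapted and $\lambda\in\mathbb{R}$ a constant. It is bounded if $Y$ is uniformly bounded, and stationary Markovian if $Y_t,Z_t$ are deterministic functions of $X_t$ not depending on $t$. *)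

theory Defs
  imports "HOL-Probability.Probability"
begin

definition states :: "(real ^ 'n) set" where
  "states = range (\<lambda>i. axis i 1)"

definition transition_matrix :: "real ^ 'n ^ 'n \<Rightarrow> bool" where
  \<comment> \<open>\<open>P $ i $ j\<close> is the probability of a jump from \<open>axis j 1\<close> to \<open>axis i 1\<close>: columns sum to one\<close>
  "transition_matrix P \<longleftrightarrow> (\<forall>i j. 0 \<le> P $ i $ j) \<and> (\<forall>j. (\<Sum>i\<in>UNIV. P $ i $ j) = 1)"

text \<open>A probability measure on \<^const>\<open>states\<close> is encoded as the vector of its point masses.\<close>

definition prob_vector :: "real ^ 'n \<Rightarrow> bool" where
  "prob_vector \<mu> \<longleftrightarrow> (\<forall>i. 0 \<le> \<mu> $ i) \<and> (\<Sum>i\<in>UNIV. \<mu> $ i) = 1"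

definition tv_norm :: "real ^ 'n \<Rightarrow> real" where
  "tv_norm \<mu> = (\<Sum>i\<in>UNIV. \<bar>\<mu> $ i\<bar>) / 2"

text \<open>The law of \<open>X\<^sub>t\<close> when \<open>X\<^sub>0\<close> has law \<open>\<mu>\<close> is \<open>((*v) A ^^ t) \<mu>\<close>.\<close>

definition uniformly_ergodic :: "real ^ 'n ^ 'n \<Rightarrow> bool" where
  "uniformly_ergodic A \<longleftrightarrow>
     (\<exists>\<pi> R \<rho>. prob_vector \<pi> \<and> 0 < R \<and> 0 < \<rho> \<and>
        (\<forall>\<mu> t. prob_vector \<mu> \<longrightarrow>
           tv_norm (((*v) A ^^ t) \<mu> - \<pi>) \<le> R * exp (- \<rho> * real t)))"

definition gamma_equivalent :: "real \<Rightarrow> real ^ 'n ^ 'n \<Rightarrow> real ^ 'n ^ 'n \<Rightarrow> bool" where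
  "gamma_equivalent \<gamma> P Q \<longleftrightarrow>
     (\<forall>i j. \<gamma> * Q $ i $ j \<le> P $ i $ j \<and> \<gamma> * P $ i $ j \<le> Q $ i $ j)"

definition natural_sigma ::
  "'w measure \<Rightarrow> (nat \<Rightarrow> 'w \<Rightarrow> real ^ 'n) \<Rightarrow> nat \<Rightarrow> 'w measure" where
  "natural_sigma M X t =
     sigma (space M) (\<Union>s\<in>{..t}. {X s -` S \<inter> space M | S. S \<in> sets borel})"

text \<open>The measure is restricted before completing, so that only subsets of null sets of
  \<open>\<sigma>(X\<^sub>0, \<dots>, X\<^sub>t)\<close> are added.\<close>

definition history ::
  "'w measure \<Rightarrow> (nat \<Rightarrow> 'w \<Rightarrow> real ^ 'n) \<Rightarrow> nat \<Rightarrow> 'w measure" where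
  "history M X t = completion (restr_to_subalg M (natural_sigma M X t))"

definition adapted ::
  "'w measure \<Rightarrow> (nat \<Rightarrow> 'w \<Rightarrow> real ^ 'n) \<Rightarrow> (nat \<Rightarrow> 'w \<Rightarrow> 'b::topological_space) \<Rightarrow> bool" where
  "adapted M X V \<longleftrightarrow> (\<forall>t. V t \<in> history M X t \<rightarrow>\<^sub>M borel)"

text \<open>Under \<open>Q\<close>, the conditional probability of \<open>X\<^sub>t\<^sub>+\<^sub>1 = axis i 1\<close> given \<open>\<F>\<^sub>t\<close> is the
  \<open>i\<close>-th entry of \<open>P X\<^sub>t\<close>, for a possibly random matrix \<open>P\<close>. The filtration always
  comes from the reference measure \<open>M\<close>.\<close>

definition jumps_by ::
  "'w measure \<Rightarrow> (nat \<Rightarrow> 'w \<Rightarrow> real ^ 'n) \<Rightarrow> 'w measure \<Rightarrow> nat \<Rightarrow> ('w \<Rightarrow> real ^ 'n ^ 'n) \<Rightarrow> bool" where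
  "jumps_by M X Q t P \<longleftrightarrow>
     (\<forall>i. AE \<omega> in Q.
        real_cond_exp Q (history M X t) (indicator {\<omega> \<in> space M. X (Suc t) \<omega> = axis i 1}) \<omega>
          = (P \<omega> *v X t \<omega>) $ i)"

definition markov_chain ::
  "'w measure \<Rightarrow> (nat \<Rightarrow> 'w \<Rightarrow> real ^ 'n) \<Rightarrow> real ^ 'n ^ 'n \<Rightarrow> bool" where
  "markov_chain M X A \<longleftrightarrow>
     (\<forall>t. X t \<in> M \<rightarrow>\<^sub>M borel) \<and> (\<forall>t. \<forall>\<omega>\<in>space M. X t \<omega> \<in> states) \<and>
     (\<forall>t. jumps_by M X M t (\<lambda>_. A))"

text \<open>The law of the controlled chain is needed only up to the finite horizons \<open>T\<close> occurring in
  the ergodic cost, so it is taken on \<open>\<F>\<^sub>T\<close>. There it exists and is unique whenever the control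
  is adapted, \<open>x\<close> has positive mass under the law of \<open>X\<^sub>0\<close>, and every \<open>B u\<close> is
  \<open>\<gamma>\<close>-equivalent to the transition matrix of \<open>X\<close>; on an arbitrary \<open>\<Omega>\<close> these laws need not
  extend to a measure on \<open>\<sigma>(\<Union>\<^sub>T \<F>\<^sub>T)\<close>.\<close>

definition is_controlled_law ::
  "'w measure \<Rightarrow> (nat \<Rightarrow> 'w \<Rightarrow> real ^ 'n) \<Rightarrow> ('u \<Rightarrow> real ^ 'n ^ 'n) \<Rightarrow> (nat \<Rightarrow> 'w \<Rightarrow> 'u)
     \<Rightarrow> real ^ 'n \<Rightarrow> nat \<Rightarrow> 'w measure \<Rightarrow> bool" where
  "is_controlled_law M X B U x T Q \<longleftrightarrow>
     prob_space Q \<and> sets Q = sets (history M X T) \<and>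
     (AE \<omega> in Q. X 0 \<omega> = x) \<and>
     (\<forall>t<T. jumps_by M X Q t (\<lambda>\<omega>. B (U t \<omega>)))"

definition controlled_law ::
  "'w measure \<Rightarrow> (nat \<Rightarrow> 'w \<Rightarrow> real ^ 'n) \<Rightarrow> ('u \<Rightarrow> real ^ 'n ^ 'n) \<Rightarrow> (nat \<Rightarrow> 'w \<Rightarrow> 'u)
     \<Rightarrow> real ^ 'n \<Rightarrow> nat \<Rightarrow> 'w measure" where
  "controlled_law M X B U x T = (THE Q. is_controlled_law M X B U x T Q)"

definition ergodic_cost ::
  "'w measure \<Rightarrow> (nat \<Rightarrow> 'w \<Rightarrow> real ^ 'n) \<Rightarrow> ('u \<Rightarrow> real ^ 'n ^ 'n) \<Rightarrow> (real ^ 'n \<Rightarrow> 'u \<Rightarrow> real)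
     \<Rightarrow> real ^ 'n \<Rightarrow> (nat \<Rightarrow> 'w \<Rightarrow> 'u) \<Rightarrow> ereal" where
  "ergodic_cost M X B L x U =
     limsup (\<lambda>T. ereal (1 / real T *
       (\<integral>\<omega>. (\<Sum>s<T. L (X s \<omega>) (U s \<omega>)) \<partial>controlled_law M X B U x T)))"

definition hamiltonian ::
  "real ^ 'n ^ 'n \<Rightarrow> ('u \<Rightarrow> real ^ 'n ^ 'n) \<Rightarrow> (real ^ 'n \<Rightarrow> 'u \<Rightarrow> real)
     \<Rightarrow> real ^ 'n \<Rightarrow> real ^ 'n \<Rightarrow> real" where
  "hamiltonian A B L x z = (INF u. L x u + z \<bullet> ((B u - A) *v x))"

definition ebsde_solution ::
  "'w measure \<Rightarrow> (nat \<Rightarrow> 'w \<Rightarrow> real ^ 'n) \<Rightarrow> real ^ 'n ^ 'n \<Rightarrow> (real ^ 'n \<Rightarrow> real ^ 'n \<Rightarrow> real)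
     \<Rightarrow> (nat \<Rightarrow> 'w \<Rightarrow> real) \<Rightarrow> (nat \<Rightarrow> 'w \<Rightarrow> real ^ 'n) \<Rightarrow> real \<Rightarrow> bool" where
  "ebsde_solution M X A f Y Z l \<longleftrightarrow>
     adapted M X Y \<and> adapted M X Z \<and>
     (AE \<omega> in M. \<forall>t T. t < T \<longrightarrow>
        Y T \<omega> = Y t \<omega> - (\<Sum>u\<in>{t..<T}. f (X u \<omega>) (Z u \<omega>) - l)
              + (\<Sum>u\<in>{t..<T}. Z u \<omega> \<bullet> (X (Suc u) \<omega> - A *v X u \<omega>)))"

definition bounded_process :: "'w measure \<Rightarrow> (nat \<Rightarrow> 'w \<Rightarrow> real) \<Rightarrow> bool" where
  "bounded_process M Y \<longleftrightarrow> (\<exists>C. AE \<omega> in M. \<forall>t. \<bar>Y t \<omega>\<bar> \<le> C)"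

definition stationary_markovian ::
  "'w measure \<Rightarrow> (nat \<Rightarrow> 'w \<Rightarrow> real ^ 'n) \<Rightarrow> (nat \<Rightarrow> 'w \<Rightarrow> real) \<Rightarrow> (nat \<Rightarrow> 'w \<Rightarrow> real ^ 'n) \<Rightarrow> bool" where
  "stationary_markovian M X Y Z \<longleftrightarrow>
     (\<exists>y z. AE \<omega> in M. \<forall>t. Y t \<omega> = y (X t \<omega>) \<and> Z t \<omega> = z (X t \<omega>))"

definition minimizing_selector ::
  "real ^ 'n ^ 'n \<Rightarrow> ('u::topological_space \<Rightarrow> real ^ 'n ^ 'n) \<Rightarrow> (real ^ 'n \<Rightarrow> 'u \<Rightarrow> real)
     \<Rightarrow> (real ^ 'n \<Rightarrow> real ^ 'n \<Rightarrow> 'u) \<Rightarrow> bool" where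
  "minimizing_selector A B L \<kappa> \<longleftrightarrow>
     (\<lambda>(x, z). \<kappa> x z) \<in> restrict_space borel states \<Otimes>\<^sub>M borel \<rightarrow>\<^sub>M borel \<and>
     (\<forall>x\<in>states. \<forall>z. hamiltonian A B L x z = L x (\<kappa> x z) + z \<bullet> ((B (\<kappa> x z) - A) *v x))"

end

theory Submission
  imports Defs
begin

text \<open>With constant \<open>Z = y\<close> and \<open>Y\<^sub>t = y \<bullet> X\<^sub>t\<close> the equation becomes the average cost optimality equation for
  \<open>y\<close>. By uniform ergodicity some power of \<open>A\<close> has a row bounded away from zero; since every \<open>B u\<close>
  dominates \<open>\<gamma> A\<close>, an iterate of the Bellman operator contracts the span seminorm, and Banach's theorem
  gives \<open>y\<close>.

  For a control \<open>U\<close>, the measure with density \<open>\<Prod>\<^sub>s (B(U\<^sub>s) X\<^sub>s)\<^sub>i / (A X\<^sub>s)\<^sub>i\<close>, \<open>X\<^sub>s\<^sub>+\<^sub>1 = e\<^sub>i\<close>, started at \<open>x\<close>, is the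
  controlled law. Under it \<open>Z\<^sub>s \<bullet> (X\<^sub>s\<^sub>+\<^sub>1 - B(U\<^sub>s) X\<^sub>s)\<close> has mean zero, so for any bounded solution the
  expected cost up to \<open>T\<close> is \<open>\<lambda> T + O(1)\<close> plus the expected sum of the nonnegative gaps
  \<open>L(X\<^sub>s, U\<^sub>s) + Z\<^sub>s \<bullet> (B(U\<^sub>s) - A) X\<^sub>s - f(X\<^sub>s, Z\<^sub>s)\<close>. Hence \<open>J \<ge> \<lambda>\<close>, with equality as soon as the gaps are
  summable. Controls with gaps at most \<open>2\<^sup>-\<^sup>s\<close> always exist, which also gives uniqueness of \<open>\<lambda>\<close>.\<close>

section \<open>The average cost optimality equation\<close>

text \<open>A bounded solution carries no moment bound on \<open>Z\<close>. What helps is that, up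
  to null sets, the history of a finite chain up to a fixed time is a finite sigma-algebra: every
  adapted real quantity is essentially bounded, and all integrals up to a horizon exist. A
  controlled law is specified by its conditional jump probabilities alone, while the histories are
  completed with null sets of \<open>M\<close>. Uniqueness is therefore proved on the uncompleted
  histories, by induction on time, and absolute continuity comes out of that induction. The two
  halves of the \<gamma>-equivalence have separate tasks: \<open>\<gamma> * A \<le> B u\<close>
  makes the Bellman operator contract, \<open>\<gamma> * B u \<le> A\<close> makes the density well
  defined. There is no metric on the whole control space. Exact minimizers are selected in each
  compact piece separately; for approximate ones countably many controls are enough. The constant is
  unique because two solutions can be compared along one control: its cost equals the constant of
  the first and is bounded below by that of the second.\<close>

lemma axis_in_states [simp]: "axis i 1 \<in> states"
  by (simp add: states_def)

lemma statesE:
  assumes "x \<in> states"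
  obtains i where "x = axis i 1"
  using assms by (auto simp: states_def)

lemma finite_states: "finite (states :: (real ^ 'n) set)"
  by (simp add: states_def)

section \<open>Column-stochastic matrices as averaging operators\<close>

lemma transition_matrix_nonneg: "transition_matrix P \<Longrightarrow> 0 \<le> P $ i $ j"
  by (simp add: transition_matrix_def)

lemma transition_matrix_sum: "transition_matrix P \<Longrightarrow> (\<Sum>i\<in>UNIV. P $ i $ j) = 1"
  by (simp add: transition_matrix_def)

lemma transition_matrix_le_1:
  assumes "transition_matrix P"
  shows "P $ i $ j \<le> 1"
proof -
  have "P $ i $ j \<le> (\<Sum>i\<in>UNIV. P $ i $ j)"
    by (rule member_le_sum) (auto simp: transition_matrix_nonneg[OF assms])
  then show ?thesis by (simp add: transition_matrix_sum[OF assms])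
qed

lemma matrix_vector_axis: "(P *v axis j 1) $ i = (P :: real ^ 'n ^ 'm) $ i $ j"
  by (simp add: matrix_vector_mul_component inner_axis)

lemma inner_transition_axis:
  "y \<bullet> (P *v axis j 1) = (\<Sum>i\<in>UNIV. y $ i * (P :: real ^ 'n ^ 'm) $ i $ j)"
  by (simp add: inner_vec_def matrix_vector_axis)

lemma inner_axis_1: "(y :: real ^ 'n) \<bullet> axis j 1 = y $ j"
  by (simp add: inner_axis)

lemma transition_matrix_inner_ge:
  assumes "transition_matrix P" "\<And>i. a \<le> y $ i"
  shows "a \<le> y \<bullet> (P *v axis j 1)"
proof -
  have "a = (\<Sum>i\<in>UNIV. a * P $ i $ j)"
    by (simp add: transition_matrix_sum[OF assms(1)] flip: sum_distrib_left)
  also have "\<dots> \<le> (\<Sum>i\<in>UNIV. y $ i * P $ i $ j)"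
    by (intro sum_mono mult_right_mono assms transition_matrix_nonneg)
  finally show ?thesis by (simp add: inner_transition_axis)
qed

lemma transition_matrix_inner_le:
  assumes "transition_matrix P" "\<And>i. y $ i \<le> a"
  shows "y \<bullet> (P *v axis j 1) \<le> a"
  using transition_matrix_inner_ge[OF assms(1), of "-a" "-y" j] assms(2) by simp

lemma transition_matrix_inner_const:
  assumes "transition_matrix P"
  shows "(\<chi> i. c) \<bullet> (P *v axis j 1) = c"
  using transition_matrix_inner_ge[OF assms, of c "\<chi> i. c" j]
    transition_matrix_inner_le[OF assms, of "\<chi> i. c" c j] by simp

lemma transition_matrix_mult_prob_vector:
  assumes "transition_matrix P" "prob_vector \<mu>"
  shows "prob_vector (P *v \<mu>)"
proof -
  have "(\<Sum>i\<in>UNIV. (P *v \<mu>) $ i) = (\<Sum>j\<in>UNIV. (\<Sum>i\<in>UNIV. P $ i $ j) * \<mu> $ j)"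
    unfolding matrix_vector_mult_def
    by (simp add: sum_distrib_right) (rule sum.swap)
  then have "(\<Sum>i\<in>UNIV. (P *v \<mu>) $ i) = 1"
    using assms by (simp add: transition_matrix_sum prob_vector_def)
  moreover have "0 \<le> (P *v \<mu>) $ i" for i
    using assms by (simp add: matrix_vector_mult_def prob_vector_def transition_matrix_nonneg sum_nonneg)
  ultimately show ?thesis by (simp add: prob_vector_def)
qed

lemma prob_vector_axis: "prob_vector (axis j 1)"
  by (simp add: prob_vector_def axis_def)

lemma prob_vector_power:
  assumes "transition_matrix P" "prob_vector \<mu>"
  shows "prob_vector (((*v) P ^^ k) \<mu>)"
  by (induction k) (auto intro: transition_matrix_mult_prob_vector assms)

text \<open>Doeblin's condition. Choose \<open>i0\<close> charged by the limit law; convergence is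
  uniform over the starting states, so at one large time \<open>m\<close> every start puts at least
  half of the limit mass on \<open>i0\<close>.\<close>

lemma uniformly_ergodic_minorization:
  fixes A :: "real ^ 'n ^ 'n"
  assumes "uniformly_ergodic A"
  obtains m i0 \<delta> where "0 < \<delta>" "\<And>j. \<delta> \<le> ((*v) A ^^ m) (axis j 1) $ i0"
proof -
  obtain \<pi> R \<rho> where \<pi>: "prob_vector \<pi>" and "0 < R" "0 < \<rho>"
    and tv: "\<And>\<mu> t. prob_vector \<mu> \<Longrightarrow>
        tv_norm (((*v) A ^^ t) \<mu> - \<pi>) \<le> R * exp (- \<rho> * real t)"
    using assms unfolding uniformly_ergodic_def by blast
  obtain i0 where i0: "0 < \<pi> $ i0"
  proof (rule ccontr)
    assume "\<not> thesis"
    then have "\<And>i. \<pi> $ i = 0"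
      using \<pi> that unfolding prob_vector_def by (meson order_antisym_conv not_less)
    with \<pi> show False by (simp add: prob_vector_def)
  qed
  \<comment> \<open>The factor 2 undoes the division by 2 in \<open>tv_norm\<close>, which is then
    an upper bound for a single coordinate.\<close>
  have "(\<lambda>t. 2 * (R * exp (- \<rho> * real t))) \<longlonglongrightarrow> 0"
    using \<open>0 < \<rho>\<close> by real_asymp
  then have "\<forall>\<^sub>F t in sequentially. 2 * (R * exp (- \<rho> * real t)) < \<pi> $ i0 / 2"
    by (rule order_tendstoD(2)) (use i0 in simp)
  then obtain m where m: "2 * (R * exp (- \<rho> * real m)) < \<pi> $ i0 / 2"
    by (auto simp: eventually_sequentially)
  have "\<pi> $ i0 / 2 \<le> ((*v) A ^^ m) (axis j 1) $ i0" for j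
  proof -
    let ?d = "((*v) A ^^ m) (axis j 1) - \<pi>"
    have "\<bar>?d $ i0\<bar> \<le> (\<Sum>i\<in>UNIV. \<bar>?d $ i\<bar>)"
      by (rule member_le_sum) auto
    also have "\<dots> = 2 * tv_norm ?d"
      by (simp add: tv_norm_def)
    also have "\<dots> \<le> 2 * (R * exp (- \<rho> * real m))"
      using tv[OF prob_vector_axis] by simp
    also note m
    finally show ?thesis by (auto simp: abs_if split: if_splits)
  qed
  then show ?thesis using that[of "\<pi> $ i0 / 2" m i0] i0 by auto
qed

section \<open>The Bellman operator and its minorization by powers of \<open>A\<close>\<close>

locale control_data =
  fixes A :: "real ^ 'n ^ 'n"
    and B :: "'u \<Rightarrow> real ^ 'n ^ 'n"
    and L :: "real ^ 'n \<Rightarrow> 'u \<Rightarrow> real"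
    and \<gamma> :: real
  assumes A: "transition_matrix A"
    and B: "transition_matrix (B u)"
    and \<gamma>_pos: "0 < \<gamma>"
    and \<gamma>_le_1: "\<gamma> \<le> 1"
    and equiv: "gamma_equivalent \<gamma> (B u) A"
    and L_bounded: "bounded {L x u | x u. x \<in> states}"
begin

definition Lmax :: real where
  "Lmax = (SOME K. \<forall>x\<in>states. \<forall>u. \<bar>L x u\<bar> \<le> K)"

lemma L_le: "x \<in> states \<Longrightarrow> \<bar>L x u\<bar> \<le> Lmax"
proof -
  have "\<exists>K. \<forall>x\<in>states. \<forall>u. \<bar>L x u\<bar> \<le> K"
    using L_bounded unfolding bounded_iff by fastforce
  from someI_ex[OF this] show "x \<in> states \<Longrightarrow> \<bar>L x u\<bar> \<le> Lmax"
    by (simp add: Lmax_def)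
qed

lemma B_ge: "\<gamma> * A $ i $ j \<le> B u $ i $ j"
  using equiv by (simp add: gamma_equivalent_def)

text \<open>A jump impossible under \<open>A\<close> is impossible under every control, so dividing
  by entries of \<open>A\<close> in the density loses no mass.\<close>

lemma B_eq_0: "A $ i $ j = 0 \<Longrightarrow> B u $ i $ j = 0"
proof -
  assume "A $ i $ j = 0"
  moreover have "\<gamma> * B u $ i $ j \<le> A $ i $ j"
    using equiv by (simp add: gamma_equivalent_def)
  ultimately have "B u $ i $ j \<le> 0"
    using \<gamma>_pos by (simp add: mult_le_0_iff)
  then show "B u $ i $ j = 0"
    using transition_matrix_nonneg[OF B, of u i j] by simp
qed

text \<open>The dynamic programming operator, with the value function stored as a vector indexed by
  states. Written with \<open>B u\<close> instead of \<open>B u - A\<close> it is monotone and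
  commutes with adding constants; \<open>hamiltonian_bellman\<close> relates it to the
  driver.\<close>

definition bellman :: "real ^ 'n \<Rightarrow> real ^ 'n" where
  "bellman y = (\<chi> j. INF u. L (axis j 1) u + y \<bullet> (B u *v axis j 1))"

lemma bellman_bdd: "bdd_below (range (\<lambda>u. L (axis j 1) u + y \<bullet> (B u *v axis j 1)))"
proof (rule bdd_belowI2)
  fix u
  have "- norm y \<le> y $ i" for i
    using component_le_norm_cart[of y i] by (simp add: abs_le_iff)
  then have "- norm y \<le> y \<bullet> (B u *v axis j 1)"
    by (rule transition_matrix_inner_ge[OF B])
  then show "- Lmax - norm y \<le> L (axis j 1) u + y \<bullet> (B u *v axis j 1)"
    using L_le[of "axis j 1" u] by simp
qed

lemma bellman_le: "bellman y $ j \<le> L (axis j 1) u + y \<bullet> (B u *v axis j 1)"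
  unfolding bellman_def by (simp add: cINF_lower[OF bellman_bdd])

lemma bellman_ge:
  "(\<And>u. c \<le> L (axis j 1) u + y \<bullet> (B u *v axis j 1)) \<Longrightarrow> c \<le> bellman y $ j"
  unfolding bellman_def by (auto intro: cINF_greatest)

text \<open>For each control the gain from \<open>y\<close> to \<open>y'\<close> is averaged by
  \<open>B u\<close>, which dominates \<open>\<gamma> * A\<close>. The resulting bound does not
  involve the control, so it survives the infimum.\<close>

lemma bellman_minorization:
  assumes "\<And>i. y $ i \<le> y' $ i"
  shows "bellman y $ j + \<gamma> * ((y' - y) \<bullet> (A *v axis j 1)) \<le> bellman y' $ j"
proof (rule bellman_ge)
  fix u
  have "\<gamma> * ((y' - y) \<bullet> (A *v axis j 1)) \<le> (y' - y) \<bullet> (B u *v axis j 1)"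
    unfolding inner_transition_axis sum_distrib_left
  proof (rule sum_mono)
    fix i
    have "(y' - y) $ i * (\<gamma> * A $ i $ j) \<le> (y' - y) $ i * B u $ i $ j"
      using assms[of i] by (intro mult_left_mono B_ge) auto
    then show "\<gamma> * ((y' - y) $ i * A $ i $ j) \<le> (y' - y) $ i * B u $ i $ j"
      by (simp add: mult_ac)
  qed
  then show "bellman y $ j + \<gamma> * ((y' - y) \<bullet> (A *v axis j 1))
      \<le> L (axis j 1) u + y' \<bullet> (B u *v axis j 1)"
    using bellman_le[of y j u] by (simp add: inner_diff_left)
qed

text \<open>Iterating costs a factor \<open>\<gamma>\<close> per step and replaces \<open>A\<close>
  by its powers: the nonlinear operator inherits the mixing of the linear reference chain.\<close>

lemma bellman_pow_minorization:
  assumes "\<And>i. y $ i \<le> y' $ i"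
  shows "(bellman ^^ k) y $ j + \<gamma> ^ k * ((y' - y) \<bullet> (((*v) A ^^ k) (axis j 1)))
    \<le> (bellman ^^ k) y' $ j"
proof (induction k arbitrary: j)
  case 0
  then show ?case by (simp add: inner_axis_1)
next
  case (Suc k)
  let ?d = "(bellman ^^ k) y' - (bellman ^^ k) y"
  have Ak: "prob_vector (((*v) A ^^ k) (axis i 1))" for i
    by (rule prob_vector_power[OF A prob_vector_axis])
  \<comment> \<open>Nonnegative gains keep the iterates ordered, which is the premise of
    \<open>bellman_minorization\<close> at the next step.\<close>
  have w: "0 \<le> \<gamma> ^ k * ((y' - y) \<bullet> (((*v) A ^^ k) (axis i 1)))" for i
    using Ak[of i] assms \<gamma>_pos by (auto simp: inner_vec_def prob_vector_def intro!: mult_nonneg_nonneg sum_nonneg)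
  \<comment> \<open>Expanding \<open>A *v axis j 1\<close> in the basis turns \<open>k + 1\<close>
    steps from \<open>j\<close> into a mixture, with weights \<open>A $ i $ j\<close>, of
    \<open>k\<close> steps from \<open>i\<close>.\<close>
  have lin: "((*v) A ^^ k) v = (\<Sum>i\<in>UNIV. v $ i *\<^sub>R ((*v) A ^^ k) (axis i 1))" for v
  proof -
    have "linear ((*v) A ^^ k)"
    proof (induction k)
      case (Suc k)
      then show ?case
        unfolding funpow.simps by (intro linear_compose) simp_all
    qed (simp add: linear_ident id_def)
    then have "((*v) A ^^ k) (\<Sum>i\<in>UNIV. v $ i *\<^sub>R axis i 1) = (\<Sum>i\<in>UNIV. v $ i *\<^sub>R ((*v) A ^^ k) (axis i 1))"
      by (simp add: linear_sum linear_scale)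
    moreover have "(\<Sum>i\<in>UNIV. v $ i *\<^sub>R axis i 1) = v"
      using basis_expansion[of v] by (simp add: scalar_mult_eq_scaleR)
    ultimately show ?thesis by simp
  qed
  have "\<gamma> ^ Suc k * ((y' - y) \<bullet> (((*v) A ^^ Suc k) (axis j 1)))
      = \<gamma> * (\<Sum>i\<in>UNIV. \<gamma> ^ k * ((y' - y) \<bullet> (((*v) A ^^ k) (axis i 1))) * A $ i $ j)"
    unfolding funpow_Suc_right comp_def
    by (subst lin) (simp add: inner_sum_right matrix_vector_axis sum_distrib_left mult_ac)
  also have "\<dots> \<le> \<gamma> * (\<Sum>i\<in>UNIV. ?d $ i * A $ i $ j)"
    using Suc \<gamma>_pos by (intro mult_left_mono sum_mono mult_right_mono transition_matrix_nonneg[OF A])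
      (auto simp: algebra_simps)
  also have "\<dots> = \<gamma> * (?d \<bullet> (A *v axis j 1))"
    by (simp add: inner_transition_axis)
  finally show ?case
    using bellman_minorization[of "(bellman ^^ k) y" "(bellman ^^ k) y'" j] Suc w
    by (simp del: vector_minus_component) (smt (verit) w)
qed

lemma bellman_add_const: "bellman (y + (\<chi> i. c)) = bellman y + (\<chi> i. c)"
proof (rule vec_eq_iff[THEN iffD2, rule_format])
  fix j
  have *: "(y + (\<chi> i. c)) \<bullet> (B u *v axis j 1) = y \<bullet> (B u *v axis j 1) + c" for u y c
    by (simp add: inner_add_left transition_matrix_inner_const[OF B])
  show "bellman (y + (\<chi> i. c)) $ j = (bellman y + (\<chi> i. c)) $ j"
  proof (rule antisym)
    have "bellman (y + (\<chi> i. c)) $ j - c \<le> bellman y $ j"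
      using bellman_le[of "y + (\<chi> i. c)" j] unfolding *
      by (intro bellman_ge) (simp add: algebra_simps)
    then show "bellman (y + (\<chi> i. c)) $ j \<le> (bellman y + (\<chi> i. c)) $ j" by simp
    show "(bellman y + (\<chi> i. c)) $ j \<le> bellman (y + (\<chi> i. c)) $ j"
      using bellman_le[of y j] by (intro bellman_ge) (simp add: *)
  qed
qed

lemma bellman_pow_add_const: "(bellman ^^ k) (y + (\<chi> i. c)) = (bellman ^^ k) y + (\<chi> i. c)"
  by (induction k) (auto simp: bellman_add_const)

lemma bellman_pow_shift_le:
  assumes "\<And>i. y $ i + a \<le> y' $ i"
  shows "(bellman ^^ k) y $ j + a + \<gamma> ^ k * ((y' - y - (\<chi> i. a)) \<bullet> (((*v) A ^^ k) (axis j 1)))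
    \<le> (bellman ^^ k) y' $ j"
  using bellman_pow_minorization[of "y + (\<chi> i. a)" y' k j] assms
  by (simp add: bellman_pow_add_const algebra_simps)

end

section \<open>Span contraction and the additive eigenvector\<close>

definition span_bounded :: "real ^ 'n \<Rightarrow> real \<Rightarrow> bool" where
  "span_bounded d s \<longleftrightarrow> (\<forall>i j. d $ i - d $ j \<le> s)"

context control_data
begin

lemma contraction_factor_nonneg:
  assumes "\<And>j. \<delta> \<le> ((*v) A ^^ m) (axis j 1) $ i0"
  shows "0 \<le> 1 - \<gamma> ^ m * \<delta>"
proof (cases "0 \<le> \<delta>")
  case True
  fix j
  have "((*v) A ^^ m) (axis j 1) $ i0 \<le> (\<Sum>i\<in>UNIV. ((*v) A ^^ m) (axis j 1) $ i)"
    using prob_vector_power[OF A prob_vector_axis, of m j]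
    by (intro member_le_sum) (auto simp: prob_vector_def)
  then have "\<delta> \<le> 1"
    using assms[of j] prob_vector_power[OF A prob_vector_axis, of m j] by (simp add: prob_vector_def)
  then have "\<gamma> ^ m * \<delta> \<le> 1"
    using True \<gamma>_pos \<gamma>_le_1 by (intro mult_le_one power_le_one) auto
  then show ?thesis by simp
next
  case False
  then have "\<gamma> ^ m * \<delta> \<le> 0"
    using \<gamma>_pos by (simp add: mult_nonneg_nonpos)
  then show ?thesis by simp
qed

text \<open>Raising the minimal and lowering the maximal difference by the common mass \<open>\<delta>\<close> at \<open>i0\<close>
  is Doeblin's argument for the nonlinear operator.\<close>

lemma bellman_pow_span_contraction:
  assumes \<delta>: "\<And>j. \<delta> \<le> ((*v) A ^^ m) (axis j 1) $ i0" "0 \<le> \<delta>"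
    and s: "span_bounded (y' - y) s"
  shows "span_bounded ((bellman ^^ m) y' - (bellman ^^ m) y) ((1 - \<gamma> ^ m * \<delta>) * s)"
  unfolding span_bounded_def
proof (intro allI)
  fix j k
  let ?d = "y' - y"
  define a where "a = Min (range (($) ?d))"
  define b where "b = Max (range (($) ?d))"
  have a: "a \<le> ?d $ i" and b: "?d $ i \<le> b" for i
    by (auto simp: a_def b_def)
  have "a \<in> range (($) ?d)" "b \<in> range (($) ?d)"
    unfolding a_def b_def by (intro Min_in Max_in; simp)+
  then have ba: "b - a \<le> s"
    using s by (auto simp: span_bounded_def)
  \<comment> \<open>Of the whole column only the coordinate \<open>i0\<close> is kept; the other
    terms are nonnegative.\<close>
  have mass: "\<delta> * w $ i0 \<le> w \<bullet> (((*v) A ^^ m) (axis l 1))" if "\<And>i. 0 \<le> w $ i" for w l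
  proof -
    have "0 \<le> ((*v) A ^^ m) (axis l 1) $ i" for i
      using prob_vector_power[OF A prob_vector_axis, of m l] by (simp add: prob_vector_def)
    then have "w $ i0 * ((*v) A ^^ m) (axis l 1) $ i0 \<le> w \<bullet> (((*v) A ^^ m) (axis l 1))"
      unfolding inner_vec_def inner_real_def
      by (intro member_le_sum) (auto simp: that)
    moreover have "\<delta> * w $ i0 \<le> w $ i0 * ((*v) A ^^ m) (axis l 1) $ i0"
      using \<delta>(1)[of l] that[of i0] by (metis mult.commute mult_right_mono)
    ultimately show ?thesis by linarith
  qed
  have "(bellman ^^ m) y $ k + a + \<gamma> ^ m * (\<delta> * (?d $ i0 - a)) \<le> (bellman ^^ m) y' $ k"
  proof -
    have "\<gamma> ^ m * (\<delta> * (?d $ i0 - a)) \<le> \<gamma> ^ m * ((y' - y - (\<chi> i. a)) \<bullet> (((*v) A ^^ m) (axis k 1)))"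
      using mass[of "?d - (\<chi> i. a)" k] a \<gamma>_pos by (intro mult_left_mono) auto
    moreover have "(bellman ^^ m) y $ k + a + \<gamma> ^ m * ((y' - y - (\<chi> i. a)) \<bullet> (((*v) A ^^ m) (axis k 1)))
        \<le> (bellman ^^ m) y' $ k"
      using a by (intro bellman_pow_shift_le) (simp add: algebra_simps)
    ultimately show ?thesis by linarith
  qed
  \<comment> \<open>The same estimate with \<open>y\<close> and \<open>y'\<close> exchanged and
    shift \<open>- b\<close>.\<close>
  moreover have "(bellman ^^ m) y' $ j - b + \<gamma> ^ m * (\<delta> * (b - ?d $ i0)) \<le> (bellman ^^ m) y $ j"
  proof -
    have "\<gamma> ^ m * (\<delta> * (b - ?d $ i0)) \<le> \<gamma> ^ m * ((y - y' - (\<chi> i. -b)) \<bullet> (((*v) A ^^ m) (axis j 1)))"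
      using mass[of "y - y' - (\<chi> i. -b)" j] b \<gamma>_pos by (intro mult_left_mono) (auto simp: algebra_simps)
    moreover have "(bellman ^^ m) y' $ j + - b + \<gamma> ^ m * ((y - y' - (\<chi> i. - b)) \<bullet> (((*v) A ^^ m) (axis j 1)))
        \<le> (bellman ^^ m) y $ j"
      using b by (intro bellman_pow_shift_le) (simp add: algebra_simps)
    ultimately show ?thesis by linarith
  qed
  \<comment> \<open>The unknown value at \<open>i0\<close> cancels, since
    \<open>(?d $ i0 - a) + (b - ?d $ i0) = b - a\<close>; hence one state \<open>i0\<close> has to
    serve for all columns.\<close>
  ultimately have "((bellman ^^ m) y' - (bellman ^^ m) y) $ j - ((bellman ^^ m) y' - (bellman ^^ m) y) $ k
      \<le> b - a - \<gamma> ^ m * \<delta> * (b - a)"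
    by (simp add: algebra_simps)
  also have "\<dots> = (1 - \<gamma> ^ m * \<delta>) * (b - a)"
    by (simp add: algebra_simps)
  also have "\<dots> \<le> (1 - \<gamma> ^ m * \<delta>) * s"
    by (rule mult_left_mono[OF ba contraction_factor_nonneg[OF \<delta>(1)]])
  finally show "((bellman ^^ m) y' - (bellman ^^ m) y) $ j - ((bellman ^^ m) y' - (bellman ^^ m) y) $ k
      \<le> (1 - \<gamma> ^ m * \<delta>) * s" .
qed

lemma bellman_pow_span_contraction_power:
  assumes \<delta>: "\<And>j. \<delta> \<le> ((*v) A ^^ m) (axis j 1) $ i0" "0 \<le> \<delta>"
    and s: "span_bounded (y' - y) s"
  shows "span_bounded ((bellman ^^ (m * k)) y' - (bellman ^^ (m * k)) y) ((1 - \<gamma> ^ m * \<delta>) ^ k * s)"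
proof (induction k)
  case 0
  then show ?case using s by simp
next
  case (Suc k)
  show ?case
    using bellman_pow_span_contraction[OF \<delta> Suc] by (simp add: funpow_add mult.assoc)
qed

text \<open>The solution is a fixed point of an iterate of the Bellman operator normalized to vanish
  at \<open>i0\<close>; only such an iterate contracts a norm.\<close>

lemma bellman_eigenvector:
  assumes "uniformly_ergodic A"
  obtains y l where "bellman y = y + (\<chi> i. l)"
proof -
  obtain \<delta> m i0 where "0 < \<delta>" and \<delta>: "\<And>j. \<delta> \<le> ((*v) A ^^ m) (axis j 1) $ i0"
    using uniformly_ergodic_minorization[OF assms] by metis
  let ?q = "1 - \<gamma> ^ m * \<delta>"
  \<comment> \<open>The 2 bounds a span by the norm, \<open>CARD('n)\<close> bounds the norm by the
    coordinates. Choosing \<open>k\<close> to beat both leaves the contraction factor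
    \<open>1 / 2\<close>.\<close>
  let ?c = "real CARD('n) * 2"
  have q: "0 \<le> ?q" "?q < 1"
    using \<open>0 < \<delta>\<close> \<gamma>_pos contraction_factor_nonneg[OF \<delta>] by auto
  have "(\<lambda>k. ?q ^ k * ?c) \<longlonglongrightarrow> 0 * ?c"
    by (intro tendsto_intros LIMSEQ_power_zero) (use q in auto)
  then have "\<forall>\<^sub>F k in sequentially. ?q ^ k * ?c < 1 / 2"
    by (rule order_tendstoD(2)) simp
  then obtain k where k: "?q ^ k * ?c < 1 / 2"
    by (auto simp: eventually_sequentially)
  define T where "T = bellman ^^ (m * k)"
  \<comment> \<open>Subtracting the value at \<open>i0\<close> removes the constants, which the span
    does not see, so a span estimate for \<open>T\<close> becomes a norm estimate for
    \<open>H\<close>.\<close>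
  define H where "H y = T y - (\<chi> i. T y $ i0)" for y
  have "dist (H y) (H y') \<le> 1 / 2 * dist y y'" for y y'
  proof -
    have "\<bar>(y' - y) $ i\<bar> \<le> norm (y' - y)" for i
      by (rule component_le_norm_cart)
    then have "(y' - y) $ i - (y' - y) $ j \<le> 2 * norm (y' - y)" for i j
      by (smt (verit))
    then have "span_bounded (y' - y) (2 * norm (y' - y))"
      by (simp add: span_bounded_def)
    then have sp: "span_bounded (T y' - T y) (?q ^ k * (2 * norm (y' - y)))"
      unfolding T_def using \<open>0 < \<delta>\<close>
      by (intro bellman_pow_span_contraction_power[of \<delta> m i0] \<delta>) auto
    have "\<bar>(H y' - H y) $ i\<bar> \<le> ?q ^ k * (2 * norm (y' - y))" for i
    proof -
      have "(T y' - T y) $ i - (T y' - T y) $ i0 \<le> ?q ^ k * (2 * norm (y' - y))"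
        "(T y' - T y) $ i0 - (T y' - T y) $ i \<le> ?q ^ k * (2 * norm (y' - y))"
        using sp unfolding span_bounded_def by blast+
      then show ?thesis by (simp add: H_def abs_le_iff)
    qed
    then have "norm (H y' - H y) \<le> (\<Sum>i\<in>(UNIV::'n set). ?q ^ k * (2 * norm (y' - y)))"
      by (intro order_trans[OF norm_le_l1_cart] sum_mono)
    also have "\<dots> = (?q ^ k * ?c) * norm (y' - y)"
      by simp
    also have "\<dots> \<le> 1 / 2 * norm (y' - y)"
      using k by (intro mult_right_mono) auto
    finally show ?thesis by (simp add: dist_norm norm_minus_commute)
  qed
  then have "\<exists>!y. H y = y"
    by (intro banach_fix_type[of "1 / 2" H]) auto
  then obtain y where y: "H y = y" and unique: "\<And>w. H w = w \<Longrightarrow> w = y"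
    by blast
  define c where "c = T y $ i0"
  \<comment> \<open>\<open>bellman\<close> commutes with its iterate \<open>T\<close>, so the
    normalized image of \<open>y\<close> is again a fixed point of \<open>H\<close>. Uniqueness
    turns an eigenvector of the iterate into one of \<open>bellman\<close> itself.\<close>
  define w where "w = bellman y + (\<chi> i. - bellman y $ i0)"
  have Ty: "T y = y + (\<chi> i. c)"
    using y by (simp add: H_def c_def algebra_simps)
  have "T (bellman y) = bellman (T y)"
    unfolding T_def by (metis comp_def funpow.simps(2) funpow_Suc_right)
  then have "T (bellman y) = bellman y + (\<chi> i. c)"
    by (simp add: Ty bellman_add_const)
  then have "T w = bellman y + (\<chi> i. c) + (\<chi> i. - bellman y $ i0)"
    by (simp add: w_def T_def bellman_pow_add_const)
  then have "H w = w"
    by (simp add: H_def w_def vec_eq_iff)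
  then have "w = y" by (rule unique)
  then have "bellman y = y - (\<chi> i. - bellman y $ i0)"
    unfolding w_def by (metis add_diff_cancel_right')
  also have "\<dots> = y + (\<chi> i. bellman y $ i0)"
    by (simp add: vec_eq_iff)
  finally show ?thesis by (rule that)
qed

end

section \<open>Histories of a finite chain\<close>

lemma space_natural_sigma [simp]: "space (natural_sigma M X t) = space M"
  unfolding natural_sigma_def by (rule space_measure_of) auto

lemma sets_natural_sigma:
  "sets (natural_sigma M X t) =
    sigma_sets (space M) (\<Union>s\<in>{..t}. {X s -` S \<inter> space M | S. S \<in> sets borel})"
  unfolding natural_sigma_def by (rule sets_measure_of) auto

lemma natural_sigma_vimage:
  "s \<le> t \<Longrightarrow> S \<in> sets borel \<Longrightarrow> X s -` S \<inter> space M \<in> sets (natural_sigma M X t)"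
  unfolding sets_natural_sigma by (auto intro!: sigma_sets.Basic)

lemma measurable_natural_sigma: "s \<le> t \<Longrightarrow> X s \<in> natural_sigma M X t \<rightarrow>\<^sub>M borel"
  by (auto intro!: measurableI natural_sigma_vimage)

lemma natural_sigma_mono:
  assumes "s \<le> t"
  shows "sets (natural_sigma M X s) \<subseteq> sets (natural_sigma M X t)"
  unfolding sets_natural_sigma by (rule sigma_sets_mono') (use assms in fastforce)

lemma subalgebra_natural_sigma:
  assumes "\<And>s. X s \<in> M \<rightarrow>\<^sub>M borel"
  shows "subalgebra M (natural_sigma M X t)"
  unfolding subalgebra_def sets_natural_sigma
  using assms by (auto intro!: sets.sigma_sets_subset simp: measurable_sets)

lemma space_history [simp]: "space (history M X t) = space M"
  by (simp add: history_def space_restr_to_subalg)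

locale finite_chain = prob_space M for M :: "'w measure" +
  fixes X :: "nat \<Rightarrow> 'w \<Rightarrow> real ^ 'n"
    and A :: "real ^ 'n ^ 'n"
  assumes chain: "markov_chain M X A"
    and sets_M: "sets M = sigma_sets (space M) (\<Union>t. sets (history M X t))"
begin

abbreviation F where "F \<equiv> natural_sigma M X"

abbreviation H where "H \<equiv> history M X"

lemma X_measurable [measurable]: "X t \<in> M \<rightarrow>\<^sub>M borel"
  using chain by (simp add: markov_chain_def)

lemma X_states: "\<omega> \<in> space M \<Longrightarrow> X t \<omega> \<in> states"
  using chain by (simp add: markov_chain_def)

definition ev :: "nat \<Rightarrow> 'n \<Rightarrow> 'w set" where
  "ev t i = {\<omega> \<in> space M. X t \<omega> = axis i 1}"

lemma ev_F: "s \<le> t \<Longrightarrow> ev s i \<in> sets (F t)"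
  using natural_sigma_vimage[of s t "{axis i 1}" X M] by (simp add: ev_def vimage_def Int_def conj_commute)

lemma UN_ev: "(\<Union>i. ev t i) = space M"
  using X_states[of _ t] by (fastforce simp: ev_def states_def)

lemma disjoint_ev: "i \<noteq> j \<Longrightarrow> ev t i \<inter> ev t j = {}"
  by (auto simp: ev_def axis_eq_axis)

lemma subalgebra_F: "subalgebra M (F t)"
  by (rule subalgebra_natural_sigma) measurable

lemma F_subset_H: "sets (F t) \<subseteq> sets (H t)"
  by (auto simp: history_def sets_restr_to_subalg[OF subalgebra_F])

text \<open>Since the measure is restricted before completing, the null set \<open>N'\<close> lies
  in \<open>F t\<close> itself. Measures known only on \<open>F t\<close> can then be evaluated on
  it, as in \<open>law_eqI\<close>.\<close>

lemma H_cases: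
  assumes "S \<in> sets (H t)"
  obtains S0 N N' where "S = S0 \<union> N" "N \<subseteq> N'" "N' \<in> null_sets M" "N' \<in> sets (F t)" "S0 \<in> sets (F t)"
proof -
  have "S \<in> sets (completion (restr_to_subalg M (F t)))"
    using assms by (simp add: history_def)
  then obtain S0 N N' where "S = S0 \<union> N" "N \<subseteq> N'"
    "N' \<in> null_sets (restr_to_subalg M (F t))" "S0 \<in> sets (restr_to_subalg M (F t))"
    by (rule sets_completionE)
  then show ?thesis
    using that[of S0 N N']
    by (simp add: null_sets_restr_to_subalg[OF subalgebra_F] sets_restr_to_subalg[OF subalgebra_F])
qed

lemma HI:
  assumes "S = S0 \<union> N" "N \<subseteq> N'" "N' \<in> null_sets M" "N' \<in> sets (F t)" "S0 \<in> sets (F t)"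
  shows "S \<in> sets (H t)"
  unfolding history_def using assms
  by (intro sets_completionI[of S S0 N N'])
     (auto simp: null_sets_restr_to_subalg[OF subalgebra_F] sets_restr_to_subalg[OF subalgebra_F])

text \<open>The subsets of null sets added by completion are events of \<open>M\<close> because
  \<open>sets M\<close> is generated by the completed histories.\<close>

lemma subalgebra_H: "subalgebra M (H t)"
  unfolding subalgebra_def by (auto simp: sets_M)

lemma H_mono: "s \<le> t \<Longrightarrow> subalgebra (H t) (H s)"
proof -
  assume "s \<le> t"
  then have "sets (F s) \<subseteq> sets (F t)" by (rule natural_sigma_mono)
  then have "S \<in> sets (H t)" if "S \<in> sets (H s)" for S
    using that by (elim H_cases) (meson HI subsetD)
  then show ?thesis
    unfolding subalgebra_def by auto
qed

lemma ev_H: "s \<le> t \<Longrightarrow> ev s i \<in> sets (H t)"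
  using ev_F F_subset_H by blast

lemma X_H: "s \<le> t \<Longrightarrow> X s \<in> H t \<rightarrow>\<^sub>M borel"
  using measurable_natural_sigma[of s t X M] F_subset_H[of t]
  by (auto simp: measurable_def)

lemma measurable_H_mono: "f \<in> H s \<rightarrow>\<^sub>M N \<Longrightarrow> s \<le> t \<Longrightarrow> f \<in> H t \<rightarrow>\<^sub>M N"
  using measurable_from_subalg[OF H_mono] by blast

lemma measurable_H_M: "f \<in> H s \<rightarrow>\<^sub>M N \<Longrightarrow> f \<in> M \<rightarrow>\<^sub>M N"
  using measurable_from_subalg[OF subalgebra_H] by blast

section \<open>Finiteness of the histories\<close>

lemma F_0_cases:
  assumes "S \<in> sets (F 0)"
  shows "S \<inter> ev 0 i \<in> {{}, ev 0 i}"
  using assms unfolding sets_natural_sigma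
  by (induction rule: sigma_sets.induct) (auto simp: ev_def)

text \<open>On \<open>ev (Suc t) i\<close> the last coordinate is frozen and carries no information.
  This drives both the finiteness of the histories and the induction for uniqueness of the
  controlled law.\<close>

lemma F_Suc_cases:
  assumes "S \<in> sets (F (Suc t))"
  shows "\<exists>S'\<in>sets (F t). S \<inter> ev (Suc t) i = S' \<inter> ev (Suc t) i"
  using assms unfolding sets_natural_sigma[of M X "Suc t"]
proof (induction rule: sigma_sets.induct)
  case (Basic a)
  then obtain s S where s: "s \<le> Suc t" and S: "S \<in> sets borel" and a: "a = X s -` S \<inter> space M"
    by auto
  show ?case
  proof (cases "s \<le> t")
    case True
    then show ?thesis using natural_sigma_vimage[OF True S, of X M] a by auto
  next
    case False
    with s have "s = Suc t" by simp
    then have "a \<inter> ev (Suc t) i = (if axis i 1 \<in> S then space M else {}) \<inter> ev (Suc t) i"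
      by (auto simp: a ev_def)
    moreover have "(if axis i 1 \<in> S then space M else {}) \<in> sets (F t)"
      using sets.top[of "F t"] by simp
    ultimately show ?thesis by blast
  qed
next
  case Empty
  then show ?case by auto
next
  case (Compl a)
  then obtain S' where S': "S' \<in> sets (F t)" "a \<inter> ev (Suc t) i = S' \<inter> ev (Suc t) i" by auto
  then have "(space M - a) \<inter> ev (Suc t) i = (space M - S') \<inter> ev (Suc t) i"
    by auto
  moreover have "space M - S' \<in> sets (F t)"
    using sets.compl_sets[OF S'(1)] by simp
  ultimately show ?case by blast
next
  case (Union a)
  then obtain S' where S': "\<And>k. S' k \<in> sets (F t)" "\<And>k. a k \<inter> ev (Suc t) i = S' k \<inter> ev (Suc t) i"
    by metis
  then have "(\<Union>k. a k) \<inter> ev (Suc t) i = (\<Union>k. S' k) \<inter> ev (Suc t) i"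
    by blast
  moreover have "(\<Union>k. S' k) \<in> sets (F t)" using S'(1) by auto
  ultimately show ?case by blast
qed

text \<open>An event is the union of its traces on the finitely many sets \<open>ev t i\<close>, and
  each trace is trivial at time 0 or comes from one of the finitely many events of the previous
  time.\<close>

lemma finite_F: "finite (sets (F t))"
proof -
  have main: "finite (sets (F t))" if fin: "finite V" and V: "\<And>S i. S \<in> sets (F t) \<Longrightarrow> S \<inter> ev t i \<in> V" for V t
  proof -
    have "S = (\<Union>i. S \<inter> ev t i)" if "S \<in> sets (F t)" for S
      using UN_ev[of t] sets.sets_into_space[OF that] by auto
    then have "inj_on (\<lambda>S i. S \<inter> ev t i) (sets (F t))"
      by (intro inj_on_inverseI[of _ "\<lambda>f. \<Union>i. f i"]) simp
    moreover have "(\<lambda>S i. S \<inter> ev t i) ` sets (F t) \<subseteq> {f. \<forall>i. f i \<in> V}"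
      using V by auto
    moreover have "finite {f :: 'n \<Rightarrow> 'w set. \<forall>i. f i \<in> V}"
      using finite_set_of_finite_funs[of "UNIV :: 'n set" V undefined] fin by simp
    ultimately show ?thesis
      using finite_imageD[OF finite_subset] by blast
  qed
  show ?thesis
  proof (induction t)
    case 0
    show ?case
    proof (rule main[of "\<Union>i. {{}, ev 0 i}"])
      show "S \<inter> ev 0 i \<in> (\<Union>i. {{}, ev 0 i})" if "S \<in> sets (F 0)" for S i
        using F_0_cases[OF that, of i] by blast
    qed simp
  next
    case (Suc t)
    show ?case
    proof (rule main[of "\<Union>i. (\<lambda>S. S \<inter> ev (Suc t) i) ` sets (F t)"])
      show "finite (\<Union>i. (\<lambda>S. S \<inter> ev (Suc t) i) ` sets (F t))"
        using Suc by auto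
      show "S \<inter> ev (Suc t) i \<in> (\<Union>i. (\<lambda>S. S \<inter> ev (Suc t) i) ` sets (F t))"
        if "S \<in> sets (F (Suc t))" for S i
        using F_Suc_cases[OF that, of i] by blast
    qed
  qed
qed

lemma AE_bounded_H:
  fixes g :: "'w \<Rightarrow> real"
  assumes "g \<in> borel_measurable (H t)"
  shows "\<exists>C. AE \<omega> in M. \<bar>g \<omega>\<bar> \<le> C"
proof -
  obtain g' where g': "g' \<in> borel_measurable (F t)" and ae: "AE \<omega> in M. g \<omega> = g' \<omega>"
    using completion_ex_borel_measurable_real[of g] assms AE_restr_to_subalg[OF subalgebra_F]
      measurable_in_subalg'[OF subalgebra_F]
    unfolding history_def by blast
  \<comment> \<open>The sublevel sets exhaust the space but take only finitely many values, so
    finitely many levels already cover it.\<close>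
  define W where "W n = {\<omega> \<in> space M. \<bar>g' \<omega>\<bar> \<le> real n}" for n
  have "range W \<subseteq> sets (F t)"
  proof clarify
    fix n
    have "{\<omega> \<in> space (F t). \<bar>g' \<omega>\<bar> \<le> real n} \<in> sets (F t)"
      using g' by measurable
    then show "W n \<in> sets (F t)" by (simp add: W_def)
  qed
  then have "finite (range W)"
    using finite_F finite_subset by blast
  then obtain I where I: "finite I" "range W = W ` I"
    using finite_subset_image[of "range W" W UNIV] by blast
  have bound: "\<bar>g' \<omega>\<bar> \<le> real (Max (insert 0 I))" if "\<omega> \<in> space M" for \<omega>
  proof -
    obtain n where "\<bar>g' \<omega>\<bar> \<le> real n" using real_arch_simple by blast
    then have "\<omega> \<in> W n" using that by (simp add: W_def)
    moreover have "W n \<in> W ` I" using I by blast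
    ultimately obtain k where "k \<in> I" "\<omega> \<in> W k" by blast
    then have "\<bar>g' \<omega>\<bar> \<le> real k" by (simp add: W_def)
    also have "real k \<le> real (Max (insert 0 I))" using I \<open>k \<in> I\<close> by simp
    finally show ?thesis .
  qed
  have ae_bound: "AE \<omega> in M. \<bar>g \<omega>\<bar> \<le> real (Max (insert 0 I))"
    by (rule AE_mp[OF ae], rule AE_I2, rule impI, erule ssubst, rule bound)
  show ?thesis
    by (rule exI[where x = "real (Max (insert 0 I))"], rule ae_bound)
qed

lemma integrable_H:
  fixes g :: "'w \<Rightarrow> real"
  assumes "g \<in> borel_measurable (H t)"
  shows "integrable M g"
proof -
  from AE_bounded_H[OF assms] obtain C where C: "AE \<omega> in M. \<bar>g \<omega>\<bar> \<le> C"
    by (elim exE)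
  show ?thesis
    by (rule integrable_const_bound[OF _ measurable_H_M[OF assms], of C]) (use C in simp)
qed

end

text \<open>The test function form of \<open>jumps_by\<close>. Measure and matrix are arbitrary
  because it is applied to \<open>M\<close> with \<open>A\<close> and to an unknown controlled law
  with \<open>B (U t \<omega>)\<close>.\<close>

lemma jumps_by_integral:
  fixes h :: "'w \<Rightarrow> real"
  assumes "prob_space Q" "subalgebra Q (history M X t)" "jumps_by M X Q t P"
    and E: "{\<omega> \<in> space M. X (Suc t) \<omega> = axis i 1} \<in> sets Q"
    and h: "h \<in> borel_measurable (history M X t)" "integrable Q h"
    and P: "(\<lambda>\<omega>. (P \<omega> *v X t \<omega>) $ i) \<in> borel_measurable Q"
  shows "(\<integral>\<omega>. h \<omega> * indicator {\<omega> \<in> space M. X (Suc t) \<omega> = axis i 1} \<omega> \<partial>Q)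
    = (\<integral>\<omega>. h \<omega> * (P \<omega> *v X t \<omega>) $ i \<partial>Q)"
proof -
  interpret Q: prob_space Q by fact
  interpret finite_measure_subalgebra Q "history M X t"
    by standard fact
  let ?E = "{\<omega> \<in> space M. X (Suc t) \<omega> = axis i 1}"
  have hQ: "h \<in> borel_measurable Q" using h(2) by auto
  have "(\<integral>\<omega>. h \<omega> * indicator ?E \<omega> \<partial>Q) = (\<integral>\<omega>. h \<omega> * real_cond_exp Q (history M X t) (indicator ?E) \<omega> \<partial>Q)"
    using h E by (intro real_cond_exp_intg(2)[symmetric] integrable_real_mult_indicator) auto
  also have "\<dots> = (\<integral>\<omega>. h \<omega> * (P \<omega> *v X t \<omega>) $ i \<partial>Q)"
  proof (rule integral_cong_AE)
    show "AE \<omega> in Q. h \<omega> * real_cond_exp Q (history M X t) (indicator ?E) \<omega> = h \<omega> * (P \<omega> *v X t \<omega>) $ i"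
      using assms(3)[unfolded jumps_by_def, rule_format, of i] by eventually_elim simp
  qed (use hQ P in auto)
  finally show ?thesis .
qed

section \<open>The controlled law\<close>

locale controlled_chain = finite_chain M X A + control_data A B L \<gamma>
  for M :: "'w measure" and X :: "nat \<Rightarrow> 'w \<Rightarrow> real ^ 'n" and A :: "real ^ 'n ^ 'n"
    and B :: "'u::topological_space \<Rightarrow> real ^ 'n ^ 'n" and L :: "real ^ 'n \<Rightarrow> 'u \<Rightarrow> real"
    and \<gamma> :: real +
  assumes B_continuous: "continuous_on UNIV B"
    and L_continuous: "x \<in> states \<Longrightarrow> continuous_on UNIV (L x)"
begin

text \<open>The one-step density ratio: the indicators select the entry of the jump that occurs.
  Where the entry of \<open>A\<close> vanishes the quotient is 0 by convention, consistently with
  \<open>B_eq_0\<close>.\<close>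

definition likelihood_ratio :: "(nat \<Rightarrow> 'w \<Rightarrow> 'u) \<Rightarrow> nat \<Rightarrow> 'w \<Rightarrow> real" where
  "likelihood_ratio U s \<omega> =
    (\<Sum>i\<in>UNIV. indicator (ev (Suc s) i) \<omega> * ((B (U s \<omega>) *v X s \<omega>) $ i / (A *v X s \<omega>) $ i))"

text \<open>The first factor conditions on the start in \<open>x\<close>, which is where positive
  mass of \<open>x\<close> enters. The product exchanges the transitions \<open>A\<close> for those
  of the control, one time step at a time.\<close>

definition likelihood :: "(nat \<Rightarrow> 'w \<Rightarrow> 'u) \<Rightarrow> real ^ 'n \<Rightarrow> nat \<Rightarrow> 'w \<Rightarrow> real" where
  "likelihood U x T \<omega> =
    indicator {\<omega> \<in> space M. X 0 \<omega> = x} \<omega> / prob {\<omega> \<in> space M. X 0 \<omega> = x} *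
    (\<Prod>s<T. likelihood_ratio U s \<omega>)"

definition law :: "(nat \<Rightarrow> 'w \<Rightarrow> 'u) \<Rightarrow> real ^ 'n \<Rightarrow> nat \<Rightarrow> 'w measure" where
  "law U x T = restr_to_subalg (density M (\<lambda>\<omega>. ennreal (likelihood U x T \<omega>))) (H T)"

lemma X_component_measurable: "s \<le> t \<Longrightarrow> (\<lambda>\<omega>. X s \<omega> $ j) \<in> borel_measurable (H t)"
  by (rule measurable_compose[OF X_H borel_measurable_continuous_onI])
     (auto intro!: continuous_intros)

lemma AX_measurable: "(\<lambda>\<omega>. (A *v X s \<omega>) $ i) \<in> borel_measurable (H s)"
  unfolding matrix_vector_mult_def
  by (simp, intro borel_measurable_sum borel_measurable_times borel_measurable_const X_component_measurable order_refl)

lemma likelihood_Suc: "likelihood U x (Suc T) \<omega> = likelihood U x T \<omega> * likelihood_ratio U T \<omega>"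
  by (simp add: likelihood_def)

lemma (in -) ex_axis: "x \<in> states \<Longrightarrow> \<exists>j. x = axis j 1"
  by (auto simp: states_def)

lemma BX_nonneg: "\<omega> \<in> space M \<Longrightarrow> 0 \<le> (B u *v X s \<omega>) $ i"
  using ex_axis[OF X_states[of \<omega> s]] by (auto simp: matrix_vector_axis transition_matrix_nonneg[OF B])

lemma BX_sum: "\<omega> \<in> space M \<Longrightarrow> (\<Sum>i\<in>UNIV. (B u *v X s \<omega>) $ i) = 1"
  using ex_axis[OF X_states[of \<omega> s]] by (auto simp: matrix_vector_axis transition_matrix_sum[OF B])

lemma AX_nonneg: "\<omega> \<in> space M \<Longrightarrow> 0 \<le> (A *v X s \<omega>) $ i"
  using ex_axis[OF X_states[of \<omega> s]] by (auto simp: matrix_vector_axis transition_matrix_nonneg[OF A])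

lemma BX_eq_0: "\<omega> \<in> space M \<Longrightarrow> (A *v X s \<omega>) $ i = 0 \<Longrightarrow> (B u *v X s \<omega>) $ i = 0"
  using ex_axis[OF X_states[of \<omega> s]] by (auto simp: matrix_vector_axis B_eq_0)

lemma likelihood_ratio_nonneg: "\<omega> \<in> space M \<Longrightarrow> 0 \<le> likelihood_ratio U s \<omega>"
  unfolding likelihood_ratio_def
  by (intro sum_nonneg mult_nonneg_nonneg divide_nonneg_nonneg BX_nonneg AX_nonneg) auto

lemma likelihood_nonneg: "\<omega> \<in> space M \<Longrightarrow> 0 \<le> likelihood U x T \<omega>"
  unfolding likelihood_def
  by (intro mult_nonneg_nonneg prod_nonneg) (auto intro: likelihood_ratio_nonneg)

lemma indicator_likelihood_ratio:
  "indicator (ev (Suc s) i) \<omega> * likelihood_ratio U s \<omega>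
    = indicator (ev (Suc s) i) \<omega> * ((B (U s \<omega>) *v X s \<omega>) $ i / (A *v X s \<omega>) $ i)"
proof (cases "\<omega> \<in> ev (Suc s) i")
  case True
  then have "\<omega> \<in> ev (Suc s) k \<longleftrightarrow> k = i" for k
    using disjoint_ev[of k i "Suc s"] by blast
  then have "indicator (ev (Suc s) k) \<omega> = (if k = i then 1 else 0 :: real)" for k
    by (simp add: indicator_def)
  then have "(\<Sum>k\<in>UNIV. indicator (ev (Suc s) k) \<omega> * ((B (U s \<omega>) *v X s \<omega>) $ k / (A *v X s \<omega>) $ k))
      = (\<Sum>k\<in>UNIV. if k = i then (B (U s \<omega>) *v X s \<omega>) $ k / (A *v X s \<omega>) $ k else 0)"
    by (intro sum.cong) auto
  with True show ?thesis by (simp add: likelihood_ratio_def)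
qed simp

lemma indicator_ev_sum: "\<omega> \<in> space M \<Longrightarrow> (\<Sum>i\<in>UNIV. indicator (ev t i) \<omega>) = (1 :: real)"
proof -
  assume "\<omega> \<in> space M"
  then obtain i where "\<omega> \<in> ev t i" using UN_ev[of t] by blast
  then have "\<omega> \<in> ev t k \<longleftrightarrow> k = i" for k
    using disjoint_ev[of k i t] by blast
  then show ?thesis by (simp add: indicator_def)
qed

lemma X_level_H: "s \<le> t \<Longrightarrow> {\<omega> \<in> space M. X s \<omega> = x} \<in> sets (H t)"
  using measurable_sets[OF X_H, of s t "{x}"] by (simp add: vimage_def Int_def conj_commute)

end

section \<open>The density is a martingale and defines a controlled law\<close>

locale controlled_process = controlled_chain M X A B L \<gamma>
  for M :: "'w measure" and X :: "nat \<Rightarrow> 'w \<Rightarrow> real ^ 'n" and A :: "real ^ 'n ^ 'n"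
    and B :: "'u::topological_space \<Rightarrow> real ^ 'n ^ 'n" and L :: "real ^ 'n \<Rightarrow> 'u \<Rightarrow> real"
    and \<gamma> :: real +
  fixes U :: "nat \<Rightarrow> 'w \<Rightarrow> 'u" and x :: "real ^ 'n"
  assumes U: "adapted M X U" and x: "x \<in> states"
    and x_mass: "0 < prob {\<omega> \<in> space M. X 0 \<omega> = x}"
begin

lemma U_H: "s \<le> t \<Longrightarrow> U s \<in> H t \<rightarrow>\<^sub>M borel"
  using U measurable_H_mono unfolding adapted_def by blast

lemma BU_measurable: "s \<le> t \<Longrightarrow> (\<lambda>\<omega>. B (U s \<omega>) $ i $ j) \<in> borel_measurable (H t)"
  by (rule measurable_compose[OF U_H borel_measurable_continuous_onI])
     (auto intro!: continuous_intros B_continuous)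

lemma BX_measurable: "s \<le> t \<Longrightarrow> (\<lambda>\<omega>. (B (U s \<omega>) *v X s \<omega>) $ i) \<in> borel_measurable (H t)"
  unfolding matrix_vector_mult_def
  by (simp, intro borel_measurable_sum borel_measurable_times BU_measurable X_component_measurable)

lemma likelihood_ratio_measurable: "likelihood_ratio U s \<in> borel_measurable (H (Suc s))"
  unfolding likelihood_ratio_def
  by (intro borel_measurable_sum borel_measurable_times borel_measurable_divide BX_measurable
      measurable_H_mono[OF AX_measurable] borel_measurable_indicator ev_H) auto

lemma likelihood_measurable: "k \<le> T \<Longrightarrow> likelihood U x k \<in> borel_measurable (H T)"
  unfolding likelihood_def
  by (intro borel_measurable_times borel_measurable_prod borel_measurable_divide
      borel_measurable_indicator borel_measurable_const X_level_H
      measurable_H_mono[OF likelihood_ratio_measurable]) auto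

text \<open>On \<open>ev (Suc t) i\<close> the ratio is known at time \<open>t\<close> and joins the
  test function. Conditioning replaces the indicator by the entry of \<open>A\<close>, which cancels
  the denominator.\<close>

lemma integral_likelihood_ratio_ev:
  assumes h: "h \<in> borel_measurable (H t)"
  shows "(\<integral>\<omega>. h \<omega> * (indicator (ev (Suc t) i) \<omega> * likelihood_ratio U t \<omega>) \<partial>M)
    = (\<integral>\<omega>. h \<omega> * (B (U t \<omega>) *v X t \<omega>) $ i \<partial>M)"
proof -
  let ?h = "\<lambda>\<omega>. h \<omega> * ((B (U t \<omega>) *v X t \<omega>) $ i / (A *v X t \<omega>) $ i)"
  have h': "?h \<in> borel_measurable (H t)"
    by (intro borel_measurable_times borel_measurable_divide h BX_measurable AX_measurable) auto
  have "(\<integral>\<omega>. h \<omega> * (indicator (ev (Suc t) i) \<omega> * likelihood_ratio U t \<omega>) \<partial>M)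
      = (\<integral>\<omega>. ?h \<omega> * indicator {\<omega> \<in> space M. X (Suc t) \<omega> = axis i 1} \<omega> \<partial>M)"
    unfolding indicator_likelihood_ratio by (simp add: ev_def mult_ac)
  also have "\<dots> = (\<integral>\<omega>. ?h \<omega> * (A *v X t \<omega>) $ i \<partial>M)"
  proof (rule jumps_by_integral[OF prob_space_axioms subalgebra_H])
    show "jumps_by M X M t (\<lambda>_. A)" using chain by (simp add: markov_chain_def)
    show "{\<omega> \<in> space M. X (Suc t) \<omega> = axis i 1} \<in> events" by measurable
    show "(\<lambda>\<omega>. (A *v X t \<omega>) $ i) \<in> borel_measurable M"
      by (rule measurable_H_M[OF AX_measurable])
  qed (rule h' integrable_H[OF h'])+
  \<comment> \<open>\<open>BX_eq_0\<close> covers the points where the denominator is zero.\<close>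
  also have "\<dots> = (\<integral>\<omega>. h \<omega> * (B (U t \<omega>) *v X t \<omega>) $ i \<partial>M)"
    by (intro Bochner_Integration.integral_cong refl) (auto simp: BX_eq_0)
  finally show ?thesis .
qed

text \<open>Sum over the next state: the columns of \<open>B\<close> sum to one, so the ratio has
  conditional mean one.\<close>

lemma integral_likelihood_ratio:
  assumes h: "h \<in> borel_measurable (H t)"
  shows "(\<integral>\<omega>. h \<omega> * likelihood_ratio U t \<omega> \<partial>M) = (\<integral>\<omega>. h \<omega> \<partial>M)"
proof -
  have h': "h \<in> borel_measurable (H (Suc t))"
    by (rule measurable_H_mono[OF h]) simp
  have "(\<integral>\<omega>. h \<omega> * likelihood_ratio U t \<omega> \<partial>M)
      = (\<integral>\<omega>. (\<Sum>i\<in>UNIV. h \<omega> * (indicator (ev (Suc t) i) \<omega> * likelihood_ratio U t \<omega>)) \<partial>M)"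
    by (intro Bochner_Integration.integral_cong refl)
       (simp add: indicator_ev_sum flip: sum_distrib_left sum_distrib_right)
  also have "\<dots> = (\<Sum>i\<in>UNIV. \<integral>\<omega>. h \<omega> * (indicator (ev (Suc t) i) \<omega> * likelihood_ratio U t \<omega>) \<partial>M)"
    by (intro Bochner_Integration.integral_sum integrable_H[of _ "Suc t"] borel_measurable_times
        likelihood_ratio_measurable h' borel_measurable_indicator ev_H) auto
  also have "\<dots> = (\<Sum>i\<in>UNIV. \<integral>\<omega>. h \<omega> * (B (U t \<omega>) *v X t \<omega>) $ i \<partial>M)"
    by (simp add: integral_likelihood_ratio_ev[OF h])
  also have "\<dots> = (\<integral>\<omega>. (\<Sum>i\<in>UNIV. h \<omega> * (B (U t \<omega>) *v X t \<omega>) $ i) \<partial>M)"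
    by (intro Bochner_Integration.integral_sum[symmetric] integrable_H[of _ t] borel_measurable_times
        h BX_measurable) auto
  also have "\<dots> = (\<integral>\<omega>. h \<omega> \<partial>M)"
    by (intro Bochner_Integration.integral_cong refl) (simp add: BX_sum flip: sum_distrib_left)
  finally show ?thesis .
qed

text \<open>Factors after time \<open>k\<close> integrate out, so the laws for different horizons
  are consistent.\<close>

lemma integral_likelihood_mono:
  assumes h: "h \<in> borel_measurable (H k)" and "k \<le> T"
  shows "(\<integral>\<omega>. h \<omega> * likelihood U x T \<omega> \<partial>M) = (\<integral>\<omega>. h \<omega> * likelihood U x k \<omega> \<partial>M)"
  using \<open>k \<le> T\<close>
proof (induction T rule: dec_induct)
  case (step T)
  have "(\<lambda>\<omega>. h \<omega> * likelihood U x T \<omega>) \<in> borel_measurable (H T)"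
    using step by (intro borel_measurable_times measurable_H_mono[OF h] likelihood_measurable) auto
  from integral_likelihood_ratio[OF this] step show ?case
    by (simp add: likelihood_Suc mult_ac)
qed simp

lemma integral_likelihood: "(\<integral>\<omega>. likelihood U x T \<omega> \<partial>M) = 1"
proof -
  have "{\<omega> \<in> space M. X 0 \<omega> = x} \<in> events" by measurable
  then show ?thesis
    using integral_likelihood_mono[of "\<lambda>_. 1" 0 T] x_mass
    by (simp add: likelihood_def)
qed

text \<open>Lower the horizon to \<open>Suc t\<close>, where the last ratio accounts for the jump,
  and raise it again from \<open>t\<close>. For indicator test functions this is the conditional
  jump probability under the new law.\<close>

lemma integral_likelihood_jump:
  assumes h: "h \<in> borel_measurable (H t)" and "t < T"
  shows "(\<integral>\<omega>. h \<omega> * indicator (ev (Suc t) i) \<omega> * likelihood U x T \<omega> \<partial>M)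
    = (\<integral>\<omega>. h \<omega> * (B (U t \<omega>) *v X t \<omega>) $ i * likelihood U x T \<omega> \<partial>M)"
proof -
  have "(\<integral>\<omega>. h \<omega> * indicator (ev (Suc t) i) \<omega> * likelihood U x T \<omega> \<partial>M)
      = (\<integral>\<omega>. h \<omega> * indicator (ev (Suc t) i) \<omega> * likelihood U x (Suc t) \<omega> \<partial>M)"
    using \<open>t < T\<close> by (intro integral_likelihood_mono borel_measurable_times borel_measurable_indicator
        measurable_H_mono[OF h] ev_H) auto
  also have "\<dots> = (\<integral>\<omega>. (h \<omega> * likelihood U x t \<omega>) * (indicator (ev (Suc t) i) \<omega> * likelihood_ratio U t \<omega>) \<partial>M)"
    by (simp add: likelihood_Suc mult_ac)
  also have "\<dots> = (\<integral>\<omega>. (h \<omega> * likelihood U x t \<omega>) * (B (U t \<omega>) *v X t \<omega>) $ i \<partial>M)"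
    by (intro integral_likelihood_ratio_ev borel_measurable_times h likelihood_measurable) simp
  also have "\<dots> = (\<integral>\<omega>. h \<omega> * (B (U t \<omega>) *v X t \<omega>) $ i * likelihood U x t \<omega> \<partial>M)"
    by (simp add: mult_ac)
  also have "\<dots> = (\<integral>\<omega>. h \<omega> * (B (U t \<omega>) *v X t \<omega>) $ i * likelihood U x T \<omega> \<partial>M)"
    using \<open>t < T\<close> by (intro integral_likelihood_mono[symmetric] borel_measurable_times h BX_measurable) auto
  finally show ?thesis .
qed

abbreviation P where "P T \<equiv> density M (\<lambda>\<omega>. ennreal (likelihood U x T \<omega>))"

lemma likelihood_M [measurable]: "likelihood U x T \<in> borel_measurable M"
  by (rule measurable_H_M[OF likelihood_measurable[OF order_refl]])

lemma subalgebra_P: "subalgebra (P T) (H t)"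
  using subalgebra_H[of t] by (simp add: subalgebra_def)

lemma AE_likelihood_nonneg: "AE \<omega> in M. 0 \<le> likelihood U x T \<omega>"
  by (rule AE_I2) (rule likelihood_nonneg)

lemma emeasure_P:
  assumes "S \<in> events"
  shows "emeasure (P T) S = ennreal (\<integral>\<omega>. indicator S \<omega> * likelihood U x T \<omega> \<partial>M)"
proof -
  have "emeasure (P T) S = (\<integral>\<^sup>+\<omega>. ennreal (indicator S \<omega> * likelihood U x T \<omega>) \<partial>M)"
    using assms by (subst emeasure_density) (auto intro!: nn_integral_cong split: split_indicator)
  also have "\<dots> = ennreal (\<integral>\<omega>. indicator S \<omega> * likelihood U x T \<omega> \<partial>M)"
    using assms integrable_H[OF likelihood_measurable[OF order_refl, of T]] AE_likelihood_nonneg[of T]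
    by (intro nn_integral_eq_integral)
       (auto simp: mult.commute[of "indicator S _"] intro!: integrable_real_mult_indicator)
  finally show ?thesis .
qed

lemma prob_space_P: "prob_space (P T)"
proof
  have "(\<integral>\<omega>. indicator (space M) \<omega> * likelihood U x T \<omega> \<partial>M) = (\<integral>\<omega>. likelihood U x T \<omega> \<partial>M)"
    by (intro Bochner_Integration.integral_cong) auto
  then show "emeasure (P T) (space (P T)) = 1"
    by (simp add: emeasure_P integral_likelihood)
qed

lemma sets_law: "sets (law U x T) = sets (H T)"
  unfolding law_def by (rule sets_restr_to_subalg[OF subalgebra_P])

lemma space_law: "space (law U x T) = space M"
  by (simp add: law_def space_restr_to_subalg)

lemma prob_space_law: "prob_space (law U x T)"
  unfolding law_def by (rule prob_space_restr_to_subalg[OF subalgebra_P prob_space_P])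

lemma integral_law:
  fixes g :: "'w \<Rightarrow> real"
  assumes g: "g \<in> borel_measurable (H T)"
  shows "(\<integral>\<omega>. g \<omega> \<partial>law U x T) = (\<integral>\<omega>. g \<omega> * likelihood U x T \<omega> \<partial>M)"
proof -
  have "(\<integral>\<omega>. g \<omega> \<partial>law U x T) = (\<integral>\<omega>. g \<omega> \<partial>P T)"
    unfolding law_def by (rule integral_subalgebra2[OF subalgebra_P g])
  also have "\<dots> = (\<integral>\<omega>. likelihood U x T \<omega> *\<^sub>R g \<omega> \<partial>M)"
    by (rule integral_density[OF measurable_H_M[OF g] likelihood_M AE_likelihood_nonneg])
  finally show ?thesis by (simp add: mult_ac)
qed

lemma integrable_law:
  fixes g :: "'w \<Rightarrow> real"
  assumes g: "g \<in> borel_measurable (H T)"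
  shows "integrable (law U x T) g"
  unfolding law_def
proof (rule integrable_in_subalg[OF subalgebra_P g])
  have "integrable M (\<lambda>\<omega>. likelihood U x T \<omega> *\<^sub>R g \<omega>)"
    using likelihood_measurable[OF order_refl, of T] g by (intro integrable_H[of _ T]) simp
  then show "integrable (P T) g"
    by (subst integrable_density) (auto simp: AE_likelihood_nonneg measurable_H_M[OF g])
qed

lemma subalgebra_law: "t \<le> T \<Longrightarrow> subalgebra (law U x T) (H t)"
  using H_mono[of t T] by (simp add: subalgebra_def sets_law space_law)

lemma is_controlled_law_law: "is_controlled_law M X B U x T (law U x T)"
  unfolding is_controlled_law_def jumps_by_def
proof (intro conjI allI impI)
  have "AE \<omega> in P T. X 0 \<omega> = x"
  proof (subst AE_density)
    show "AE \<omega> in M. 0 < ennreal (likelihood U x T \<omega>) \<longrightarrow> X 0 \<omega> = x"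
      by (rule AE_I2) (auto simp: likelihood_def split: split_indicator_asm)
  qed measurable
  moreover have "(\<lambda>\<omega>. X 0 \<omega> = x) \<in> H T \<rightarrow>\<^sub>M count_space UNIV"
    using X_level_H[of 0 T x] by (simp add: pred_def)
  ultimately show "AE \<omega> in law U x T. X 0 \<omega> = x"
    unfolding law_def by (rule AE_restr_to_subalg2[OF subalgebra_P])
next
  fix t i assume t: "t < T"
  interpret Q: prob_space "law U x T" by (rule prob_space_law)
  interpret finite_measure_subalgebra "law U x T" "H t"
    by standard (use t subalgebra_law in simp)
  show "AE \<omega> in law U x T. real_cond_exp (law U x T) (H t)
      (indicator {\<omega> \<in> space M. X (Suc t) \<omega> = axis i 1}) \<omega> = (B (U t \<omega>) *v X t \<omega>) $ i"
    unfolding ev_def[symmetric]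
  proof (rule real_cond_exp_charact)
    fix S assume S: "S \<in> sets (H t)"
    then have S': "S \<in> sets (H T)"
      using H_mono[of t T] t by (auto simp: subalgebra_def)
    have "(\<integral>\<omega>. indicator S \<omega> * indicator (ev (Suc t) i) \<omega> \<partial>law U x T)
        = (\<integral>\<omega>. indicator S \<omega> * (B (U t \<omega>) *v X t \<omega>) $ i \<partial>law U x T)"
      using t S S' by (subst (1 2) integral_law)
        (auto intro!: integral_likelihood_jump borel_measurable_times borel_measurable_indicator ev_H BX_measurable)
    then show "(\<integral>\<omega>\<in>S. indicator (ev (Suc t) i) \<omega> \<partial>law U x T)
        = (\<integral>\<omega>\<in>S. (B (U t \<omega>) *v X t \<omega>) $ i \<partial>law U x T)"
      by (simp add: set_lebesgue_integral_def)
  qed (use t in \<open>auto intro!: integrable_law borel_measurable_indicator ev_H BX_measurable\<close>)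
qed (simp_all add: prob_space_law sets_law)

section \<open>Uniqueness of the controlled law\<close>

lemma law_eqI:
  assumes "prob_space Q" and sub: "subalgebra Q (H k)"
    and eq: "\<And>S. S \<in> sets (F k) \<Longrightarrow> measure Q S = (\<integral>\<omega>. indicator S \<omega> * likelihood U x k \<omega> \<partial>M)"
  shows "restr_to_subalg Q (H k) = law U x k"
proof (rule measure_eqI)
  interpret Q: prob_space Q by fact
  show "sets (restr_to_subalg Q (H k)) = sets (law U x k)"
    by (simp add: sets_law sets_restr_to_subalg[OF sub])
  fix S assume "S \<in> sets (restr_to_subalg Q (H k))"
  then have S: "S \<in> sets (H k)" by (simp add: sets_restr_to_subalg[OF sub])
  then obtain S0 N N' where N: "S = S0 \<union> N" "N \<subseteq> N'" "N' \<in> null_sets M" "N' \<in> sets (F k)" "S0 \<in> sets (F k)"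
    by (rule H_cases)
  have FQ: "sets (F k) \<subseteq> Q.events"
    using F_subset_H[of k] sub by (auto simp: subalgebra_def)
  have SM: "S \<in> events" using S subalgebra_H[of k] by (auto simp: subalgebra_def)
  have SQ: "S \<in> Q.events" using S sub by (auto simp: subalgebra_def)
  have "AE \<omega> in M. \<omega> \<notin> N'" using N(3) by (rule AE_not_in)
  then have eqS: "(\<integral>\<omega>. indicator S \<omega> * likelihood U x k \<omega> \<partial>M) = (\<integral>\<omega>. indicator S0 \<omega> * likelihood U x k \<omega> \<partial>M)"
    using N SM subalgebra_F[of k]
    by (intro integral_cong_AE) (auto simp: subalgebra_def split: split_indicator)
  \<comment> \<open>Agreement on \<open>F k\<close> applies to \<open>N'\<close> and makes it null
    for \<open>Q\<close> too: absolute continuity on the completed history is derived here, not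
    assumed.\<close>
  have "measure Q N' = (\<integral>\<omega>. 0 \<partial>M)"
    unfolding eq[OF N(4)] using \<open>AE \<omega> in M. \<omega> \<notin> N'\<close> N(3)
    by (intro integral_cong_AE) (auto simp: null_sets_def)
  then have "N' \<in> null_sets Q" using N(4) FQ
    by (auto simp: null_sets_def Q.emeasure_eq_measure)
  then have "AE \<omega> in Q. \<omega> \<notin> N'" by (rule AE_not_in)
  then have "measure Q S = measure Q S0"
    using N FQ SQ by (intro Q.finite_measure_eq_AE) auto
  then have "emeasure Q S = emeasure (P k) S"
    using eq[OF N(5)] eqS SM by (simp add: Q.emeasure_eq_measure emeasure_P)
  then show "emeasure (restr_to_subalg Q (H k)) S = emeasure (law U x k) S"
    using S by (simp add: law_def emeasure_restr_to_subalg sub subalgebra_P)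
qed

text \<open>Induction on \<open>k\<close> with \<open>Q\<close> fixed. An event of
  \<open>F (Suc k)\<close> is split along the last state; each piece is an event of
  \<open>F k\<close> followed by a jump of prescribed probability, so the previous stage determines
  it.\<close>

lemma controlled_law_unique:
  assumes Q: "is_controlled_law M X B U x T Q" and "k \<le> T"
  shows "restr_to_subalg Q (H k) = law U x k"
  using \<open>k \<le> T\<close>
proof (induction k)
  interpret Q: prob_space Q using Q by (simp add: is_controlled_law_def)
  have setsQ: "sets Q = sets (H T)" using Q by (simp add: is_controlled_law_def)
  have spaceQ: "space Q = space M" using sets_eq_imp_space_eq[OF setsQ] by simp
  have sub: "subalgebra Q (H k)" if "k \<le> T" for k
    using H_mono[OF that] setsQ spaceQ by (simp add: subalgebra_def)
  have FQ: "sets (F k) \<subseteq> Q.events" if "k \<le> T" for k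
    using F_subset_H[of k] sub[OF that] by (auto simp: subalgebra_def)
  have FM: "sets (F k) \<subseteq> events" for k
    using subalgebra_F[of k] by (auto simp: subalgebra_def)
  {
    case 0
    obtain j where j: "x = axis j 1" using ex_axis[OF x] by blast
    have ev0: "{\<omega> \<in> space M. X 0 \<omega> = x} = ev 0 j" by (simp add: j ev_def)
    have ae: "AE \<omega> in Q. \<omega> \<in> ev 0 j"
      using Q AE_space by (auto simp: is_controlled_law_def ev_def j spaceQ elim: eventually_elim2)
    show ?case
    proof (rule law_eqI[OF Q.prob_space_axioms sub[OF 0]])
      fix S assume S: "S \<in> sets (F 0)"
      have "ev 0 j \<in> sets (F 0)" by (rule ev_F) simp
      then have evQ: "ev 0 j \<in> Q.events" and evM: "ev 0 j \<in> events"
        using FQ[OF 0] FM by blast+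
      have SQ: "S \<in> Q.events" and SM: "S \<in> events" using S FQ[OF 0] FM by blast+
      have "measure Q S = measure Q (S \<inter> ev 0 j)"
        using ae SQ evQ by (intro Q.finite_measure_eq_AE) auto
      moreover have "measure Q (ev 0 j) = 1"
        using ae evQ by (simp add: Q.prob_eq_1)
      moreover have "(\<integral>\<omega>. indicator S \<omega> * likelihood U x 0 \<omega> \<partial>M) = prob (S \<inter> ev 0 j) / prob (ev 0 j)"
      proof -
        have "(\<integral>\<omega>. indicator S \<omega> * likelihood U x 0 \<omega> \<partial>M)
            = (\<integral>\<omega>. indicator (S \<inter> ev 0 j) \<omega> / prob (ev 0 j) \<partial>M)"
          by (intro Bochner_Integration.integral_cong refl) (simp add: likelihood_def ev0 indicator_inter_arith)
        then show ?thesis using SM evM by simp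
      qed
      moreover have "prob (ev 0 j) \<noteq> 0" using x_mass ev0 by simp
      \<comment> \<open>By \<open>F_0_cases\<close> the event contains \<open>ev 0 j\<close> or
        misses it, so both sides are 1 or both are 0.\<close>
      ultimately show "measure Q S = (\<integral>\<omega>. indicator S \<omega> * likelihood U x 0 \<omega> \<partial>M)"
        using F_0_cases[OF S, of j] by auto
    qed
  next
    case (Suc k)
    then have k: "k < T" and IH: "restr_to_subalg Q (H k) = law U x k" by auto
    \<comment> \<open>Equality on \<open>H k\<close> turns \<open>Q\<close>-integrals of functions
      known at time \<open>k\<close> into \<open>M\<close>-integrals against
      \<open>likelihood\<close>.\<close>
    have IH_int: "(\<integral>\<omega>. h \<omega> \<partial>Q) = (\<integral>\<omega>. h \<omega> * likelihood U x k \<omega> \<partial>M)" "integrable Q h"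
      if "h \<in> borel_measurable (H k)" for h :: "'w \<Rightarrow> real"
      using integral_subalgebra2[OF sub that] integral_law[OF that] k IH
        integrable_from_subalg[OF sub, of k h] integrable_law[OF that] by simp_all
    show ?case
    proof (rule law_eqI[OF Q.prob_space_axioms sub[OF Suc.prems]])
      fix S assume S: "S \<in> sets (F (Suc k))"
      have SQ: "S \<in> Q.events" and SM: "S \<in> events" using S FQ[OF Suc.prems] FM by blast+
      have evF: "ev (Suc k) i \<in> sets (F (Suc k))" for i by (rule ev_F) simp
      then have evQ: "ev (Suc k) i \<in> Q.events" and evM: "ev (Suc k) i \<in> events" for i
        using FQ[OF Suc.prems] FM by blast+
      obtain S' where S': "\<And>i. S' i \<in> sets (F k)" "\<And>i. S \<inter> ev (Suc k) i = S' i \<inter> ev (Suc k) i"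
        using F_Suc_cases[OF S] by metis
      have S'H: "S' i \<in> sets (H k)" for i using S'(1) F_subset_H by blast
      have "S = (\<Union>i. S \<inter> ev (Suc k) i)"
        using UN_ev[of "Suc k"] sets.sets_into_space[OF SM] by auto
      then have "measure Q S = measure Q (\<Union>i. S \<inter> ev (Suc k) i)" by simp
      also have "\<dots> = (\<Sum>i\<in>UNIV. measure Q (S \<inter> ev (Suc k) i))"
        using SQ evQ disjoint_ev[of _ _ "Suc k"]
        by (intro Q.finite_measure_finite_Union) (auto simp: disjoint_family_on_def)
      also have "\<dots> = (\<Sum>i\<in>UNIV. \<integral>\<omega>. indicator (S \<inter> ev (Suc k) i) \<omega> * likelihood U x (Suc k) \<omega> \<partial>M)"
      proof (rule sum.cong[OF refl])
        fix i
        have h: "indicat_real (S' i) \<in> borel_measurable (H k)" using S'H by auto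
        have SE: "S' i \<inter> ev (Suc k) i \<in> Q.events"
          using FQ[OF less_imp_le[OF k]] S'(1) evQ by blast
        have "measure Q (S \<inter> ev (Suc k) i)
            = (\<integral>\<omega>. indicator (S' i) \<omega> * indicator {\<omega> \<in> space M. X (Suc k) \<omega> = axis i 1} \<omega> \<partial>Q)"
          using sets.Int_space_eq2[OF SE]
          by (subst ev_def[symmetric]) (simp add: S'(2) flip: indicator_inter_arith)
        also have "\<dots> = (\<integral>\<omega>. indicator (S' i) \<omega> * (B (U k \<omega>) *v X k \<omega>) $ i \<partial>Q)"
        proof (rule jumps_by_integral[OF Q.prob_space_axioms sub])
          show "jumps_by M X Q k (\<lambda>\<omega>. B (U k \<omega>))" using Q k by (simp add: is_controlled_law_def)
          show "{\<omega> \<in> space M. X (Suc k) \<omega> = axis i 1} \<in> Q.events" using evQ by (simp add: ev_def)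
          show "(\<lambda>\<omega>. (B (U k \<omega>) *v X k \<omega>) $ i) \<in> borel_measurable Q"
            by (rule measurable_from_subalg[OF sub[of k] BX_measurable]) (use k in simp_all)
        qed (rule less_imp_le[OF k] h IH_int(2)[OF h])+
        also have "\<dots> = (\<integral>\<omega>. indicator (S' i) \<omega> * (B (U k \<omega>) *v X k \<omega>) $ i * likelihood U x k \<omega> \<partial>M)"
          by (intro IH_int borel_measurable_times h BX_measurable) simp
        also have "\<dots> = (\<integral>\<omega>. indicator (S' i) \<omega> * likelihood U x k \<omega> * (B (U k \<omega>) *v X k \<omega>) $ i \<partial>M)"
          by (simp add: mult_ac)
        \<comment> \<open>Read backwards, the ratio identity turns the prescribed jump probability
          into the next factor of the density.\<close>
        also have "\<dots> = (\<integral>\<omega>. indicator (S' i) \<omega> * likelihood U x k \<omega> *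
            (indicator (ev (Suc k) i) \<omega> * likelihood_ratio U k \<omega>) \<partial>M)"
          by (intro integral_likelihood_ratio_ev[symmetric] borel_measurable_times h likelihood_measurable) simp
        also have "\<dots> = (\<integral>\<omega>. indicator (S \<inter> ev (Suc k) i) \<omega> * likelihood U x (Suc k) \<omega> \<partial>M)"
          unfolding S'(2) by (simp add: likelihood_Suc indicator_inter_arith mult_ac)
        finally show "measure Q (S \<inter> ev (Suc k) i)
            = (\<integral>\<omega>. indicator (S \<inter> ev (Suc k) i) \<omega> * likelihood U x (Suc k) \<omega> \<partial>M)" .
      qed
      also have "\<dots> = (\<integral>\<omega>. (\<Sum>i\<in>UNIV. indicator (S \<inter> ev (Suc k) i) \<omega> * likelihood U x (Suc k) \<omega>) \<partial>M)"
        using SM evM integrable_H[OF likelihood_measurable[OF order_refl, of "Suc k"]]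
        by (intro Bochner_Integration.integral_sum[symmetric])
           (simp add: mult.commute[of "indicator _ _"] integrable_real_mult_indicator)
      also have "\<dots> = (\<integral>\<omega>. indicator S \<omega> * likelihood U x (Suc k) \<omega> \<partial>M)"
        by (intro Bochner_Integration.integral_cong refl)
           (simp add: indicator_inter_arith indicator_ev_sum flip: sum_distrib_left sum_distrib_right)
      finally show "measure Q S = (\<integral>\<omega>. indicator S \<omega> * likelihood U x (Suc k) \<omega> \<partial>M)" .
    qed
  }
qed

lemma controlled_law_eq: "controlled_law M X B U x T = law U x T"
  unfolding controlled_law_def
proof (rule the_equality, rule is_controlled_law_law)
  fix Q assume Q: "is_controlled_law M X B U x T Q"
  then have "sets Q = sets (H T)" by (simp add: is_controlled_law_def)
  \<comment> \<open>\<open>Q\<close> already lives on \<open>H T\<close>, so the restriction changes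
    nothing and the definite description denotes \<open>law U x T\<close>.\<close>
  then have "restr_to_subalg Q (H T) = Q"
    using sets_eq_imp_space_eq[of Q "H T"]
    by (intro measure_eqI) (auto simp: sets_restr_to_subalg subalgebra_def emeasure_restr_to_subalg)
  with controlled_law_unique[OF Q order_refl] show "Q = law U x T" by simp
qed

end

section \<open>The ergodic cost of a control\<close>

text \<open>All the affine functions share the Lipschitz constant \<open>c\<close>, which passes to
  the infimum. The index set varies: all controls give the driver, compact sets the constrained
  infima of \<open>closed_reward_le\<close>.\<close>

lemma continuous_INF_affine:
  fixes a :: "'u \<Rightarrow> real" and b :: "'u \<Rightarrow> 'e::real_inner"
  assumes "C \<noteq> {}" and a: "\<And>u. u \<in> C \<Longrightarrow> - K \<le> a u" and b: "\<And>u. u \<in> C \<Longrightarrow> norm (b u) \<le> c"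
  shows "continuous_on UNIV (\<lambda>z. INF u\<in>C. a u + z \<bullet> b u)"
proof -
  have diff: "z \<bullet> b u \<le> z' \<bullet> b u + c * dist z z'" if "u \<in> C" for u z z'
  proof -
    have "(z - z') \<bullet> b u \<le> norm (z - z') * norm (b u)" by (rule norm_cauchy_schwarz)
    also have "\<dots> \<le> norm (z - z') * c" by (intro mult_left_mono b that) simp
    finally show ?thesis by (simp add: inner_diff_left dist_norm mult.commute)
  qed
  have bdd: "bdd_below ((\<lambda>u. a u + z \<bullet> b u) ` C)" for z
  proof (rule bdd_belowI2)
    show "- K - c * dist 0 z \<le> a u + z \<bullet> b u" if "u \<in> C" for u
      using diff[OF that, of 0 z] a[OF that] by simp
  qed
  have le: "(INF u\<in>C. a u + z \<bullet> b u) \<le> (INF u\<in>C. a u + z' \<bullet> b u) + c * dist z z'" for z z'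
  proof -
    have "(INF u\<in>C. a u + z \<bullet> b u) - c * dist z z' \<le> (INF u\<in>C. a u + z' \<bullet> b u)"
    proof (rule cINF_greatest[OF \<open>C \<noteq> {}\<close>])
      fix u assume u: "u \<in> C"
      have "(INF u\<in>C. a u + z \<bullet> b u) \<le> a u + z \<bullet> b u"
        by (rule cINF_lower[OF bdd u])
      then show "(INF u\<in>C. a u + z \<bullet> b u) - c * dist z z' \<le> a u + z' \<bullet> b u"
        using diff[OF u, of z z'] by simp
    qed
    then show ?thesis by simp
  qed
  obtain u where "u \<in> C" using \<open>C \<noteq> {}\<close> by blast
  then have "0 \<le> c" using b[of u] norm_ge_zero[of "b u"] by linarith
  then have "c-lipschitz_on UNIV (\<lambda>z. INF u\<in>C. a u + z \<bullet> b u)"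
  proof (rule lipschitz_onI[rotated])
    fix z z' :: 'e
    show "dist (INF u\<in>C. a u + z \<bullet> b u) (INF u\<in>C. a u + z' \<bullet> b u) \<le> c * dist z z'"
      using le[of z z'] le[of z' z] by (simp add: dist_real_def abs_le_iff dist_commute)
  qed
  then show ?thesis by (rule lipschitz_on_continuous_on)
qed

section \<open>Continuity and bounds of the Hamiltonian\<close>

context control_data
begin

lemma norm_B_diff_le: "norm ((B u - A) *v axis j 1) \<le> real CARD('n)"
proof -
  have "\<bar>((B u - A) *v axis j 1) $ i\<bar> \<le> 1" for i
    using transition_matrix_le_1[OF A, of i j] transition_matrix_le_1[OF B, of u i j]
      transition_matrix_nonneg[OF A, of i j] transition_matrix_nonneg[OF B, of u i j]
    by (simp add: matrix_vector_axis abs_le_iff)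
  then have "(\<Sum>i\<in>UNIV. \<bar>((B u - A) *v axis j 1) $ i\<bar>) \<le> (\<Sum>i\<in>(UNIV::'n set). 1)"
    by (rule sum_mono)
  then show ?thesis
    using norm_le_l1_cart[of "(B u - A) *v axis j 1"] by simp
qed

lemma continuous_INF_hamiltonian:
  assumes "C \<noteq> {}"
  shows "continuous_on UNIV (\<lambda>z. INF u\<in>C. L (axis j 1) u + z \<bullet> ((B u - A) *v axis j 1))"
proof (rule continuous_INF_affine[OF assms _ norm_B_diff_le])
  show "- Lmax \<le> L (axis j 1) u" for u
    using L_le[of "axis j 1" u] by (simp add: abs_le_iff)
qed

lemma continuous_hamiltonian: "continuous_on UNIV (hamiltonian A B L (axis j 1))"
  unfolding hamiltonian_def by (rule continuous_INF_hamiltonian) simp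

lemma bdd_below_hamiltonian:
  "bdd_below ((\<lambda>u. L (axis j 1) u + z \<bullet> ((B u - A) *v axis j 1)) ` C)"
proof (rule bdd_belowI2)
  fix u
  have "\<bar>z \<bullet> ((B u - A) *v axis j 1)\<bar> \<le> norm z * norm ((B u - A) *v axis j 1)"
    by (rule Cauchy_Schwarz_ineq2)
  also have "\<dots> \<le> norm z * real CARD('n)"
    by (intro mult_left_mono norm_B_diff_le) simp
  finally show "- Lmax - norm z * real CARD('n) \<le> L (axis j 1) u + z \<bullet> ((B u - A) *v axis j 1)"
    using L_le[of "axis j 1" u] by (simp add: abs_le_iff)
qed

lemma hamiltonian_le:
  assumes "x \<in> states"
  shows "hamiltonian A B L x z \<le> L x u + z \<bullet> ((B u - A) *v x)"
proof -
  obtain j where "x = axis j 1" using assms by (rule statesE)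
  then show ?thesis
    unfolding hamiltonian_def by (auto intro!: cINF_lower bdd_below_hamiltonian)
qed

text \<open>\<open>y \<bullet> (A *v axis j 1)\<close> does not involve the control and moves
  through the infimum.\<close>

lemma hamiltonian_bellman:
  "hamiltonian A B L (axis j 1) y + y \<bullet> (A *v axis j 1) = bellman y $ j"
proof (rule antisym)
  show "hamiltonian A B L (axis j 1) y + y \<bullet> (A *v axis j 1) \<le> bellman y $ j"
    using hamiltonian_le[of "axis j 1" y]
    by (intro bellman_ge) (simp add: matrix_vector_mult_diff_rdistrib inner_diff_right algebra_simps)
  have "bellman y $ j - y \<bullet> (A *v axis j 1) \<le> hamiltonian A B L (axis j 1) y"
    unfolding hamiltonian_def
    using bellman_le[of y j]
    by (intro cINF_greatest) (simp_all add: matrix_vector_mult_diff_rdistrib inner_diff_right algebra_simps)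
  then show "bellman y $ j \<le> hamiltonian A B L (axis j 1) y + y \<bullet> (A *v axis j 1)"
    by simp
qed

end

section \<open>Existence of a stationary Markovian solution; measurability along the chain\<close>

context controlled_chain
begin

lemma ebsde_solution_exists:
  assumes "uniformly_ergodic A"
  shows "\<exists>Y Z l. ebsde_solution M X A (hamiltonian A B L) Y Z l \<and> bounded_process M Y \<and>
    stationary_markovian M X Y Z"
proof -
  obtain y l where y: "bellman y = y + (\<chi> i. l)"
    using bellman_eigenvector[OF assms] .
  let ?Y = "\<lambda>t \<omega>. y \<bullet> X t \<omega>" and ?Z = "\<lambda>(t :: nat) (\<omega> :: 'w). y"
  \<comment> \<open>The eigenvector equation at the current state makes the terms known at time
    \<open>t\<close> cancel, with \<open>l\<close> as the constant.\<close>
  have one_step: "?Y (Suc t) \<omega> = ?Y t \<omega> - (hamiltonian A B L (X t \<omega>) y - l) + y \<bullet> (X (Suc t) \<omega> - A *v X t \<omega>)"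
    if \<omega>: "\<omega> \<in> space M" for t \<omega>
  proof -
    obtain j where j: "X t \<omega> = axis j 1" using X_states[OF \<omega>, of t] by (rule statesE)
    show ?thesis
      using hamiltonian_bellman[of j y] by (simp add: j y inner_axis_1 inner_diff_right)
  qed
  have "?Y T \<omega> = ?Y t \<omega> - (\<Sum>u\<in>{t..<T}. hamiltonian A B L (X u \<omega>) y - l)
      + (\<Sum>u\<in>{t..<T}. y \<bullet> (X (Suc u) \<omega> - A *v X u \<omega>))" if \<omega>: "\<omega> \<in> space M" and "t < T" for \<omega> t T
    using less_imp_le[OF \<open>t < T\<close>]
  proof (induction T rule: dec_induct)
    case (step n)
    then show ?case
      using one_step[OF \<omega>, of n] by (simp add: sum.atLeastLessThan_Suc)
  qed simp
  moreover have "adapted M X ?Y"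
    unfolding adapted_def
    by (intro allI borel_measurable_inner borel_measurable_const X_H order_refl)
  moreover have "adapted M X ?Z"
    by (simp add: adapted_def)
  ultimately have "ebsde_solution M X A (hamiltonian A B L) ?Y ?Z l"
    by (auto simp: ebsde_solution_def intro!: AE_I2)
  moreover have "bounded_process M ?Y"
    unfolding bounded_process_def
  proof (intro exI[of _ "norm y"] AE_I2 allI)
    fix \<omega> t assume "\<omega> \<in> space M"
    then obtain j where "X t \<omega> = axis j 1" using X_states statesE by blast
    then show "\<bar>y \<bullet> X t \<omega>\<bar> \<le> norm y" by (simp add: inner_axis_1 component_le_norm_cart)
  qed
  moreover have "stationary_markovian M X ?Y ?Z"
    unfolding stationary_markovian_def
    by (intro exI[of _ "\<lambda>x. y \<bullet> x"] exI[of _ "\<lambda>_. y"]) simp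
  ultimately show ?thesis by blast
qed

text \<open>Regularity in \<open>z\<close> or in the control is available for each fixed state. As
  there are finitely many states, gluing over the sets \<open>ev s j\<close> replaces joint
  measurability.\<close>

lemma measurable_by_state:
  fixes g :: "'w \<Rightarrow> real"
  assumes "s \<le> t" and \<phi>: "\<And>j. \<phi> j \<in> borel_measurable (H t)"
    and g: "\<And>\<omega> j. \<omega> \<in> space M \<Longrightarrow> X s \<omega> = axis j 1 \<Longrightarrow> g \<omega> = \<phi> j \<omega>"
  shows "g \<in> borel_measurable (H t)"
proof -
  have m: "(\<lambda>\<omega>. \<Sum>j\<in>UNIV. indicator (ev s j) \<omega> * \<phi> j \<omega>) \<in> borel_measurable (H t)"
    by (intro borel_measurable_sum borel_measurable_times borel_measurable_indicator
        ev_H[OF \<open>s \<le> t\<close>] \<phi>)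
  have "g \<omega> = (\<Sum>j\<in>UNIV. indicator (ev s j) \<omega> * \<phi> j \<omega>)" if \<omega>: "\<omega> \<in> space (H t)" for \<omega>
  proof -
    obtain i where i: "X s \<omega> = axis i 1" using X_states[of \<omega> s] \<omega> statesE by auto
    have "(\<Sum>j\<in>UNIV. indicator (ev s j) \<omega> * \<phi> j \<omega>) = (\<Sum>j\<in>UNIV. if j = i then \<phi> j \<omega> else 0)"
      using i \<omega> by (intro sum.cong) (auto simp: ev_def axis_eq_axis)
    then show ?thesis using g[of \<omega> i] \<omega> i by simp
  qed
  then show ?thesis
    by (rule iffD2[OF measurable_cong m])
qed

lemma hamiltonian_H:
  assumes "adapted M X Z" "s \<le> t"
  shows "(\<lambda>\<omega>. hamiltonian A B L (X s \<omega>) (Z s \<omega>)) \<in> borel_measurable (H t)"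
proof (rule measurable_by_state[OF \<open>s \<le> t\<close>])
  fix j
  have "Z s \<in> borel_measurable (H t)"
    using assms measurable_H_mono unfolding adapted_def by blast
  then show "(\<lambda>\<omega>. hamiltonian A B L (axis j 1) (Z s \<omega>)) \<in> borel_measurable (H t)"
    by (rule measurable_compose) (rule borel_measurable_continuous_onI[OF continuous_hamiltonian])
qed simp

end

section \<open>The cost identity and its long-run limits\<close>

context controlled_process
begin

lemma cost_H:
  assumes "s \<le> t"
  shows "(\<lambda>\<omega>. L (X s \<omega>) (U s \<omega>)) \<in> borel_measurable (H t)"
proof (rule measurable_by_state[OF assms])
  fix j
  show "(\<lambda>\<omega>. L (axis j 1) (U s \<omega>)) \<in> borel_measurable (H t)"
    by (rule measurable_compose[OF U_H[OF assms]])
       (rule borel_measurable_continuous_onI[OF L_continuous], simp)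
qed simp

definition gap :: "(nat \<Rightarrow> 'w \<Rightarrow> real ^ 'n) \<Rightarrow> nat \<Rightarrow> 'w \<Rightarrow> real" where
  "gap Z s \<omega> = L (X s \<omega>) (U s \<omega>) + Z s \<omega> \<bullet> ((B (U s \<omega>) - A) *v X s \<omega>)
    - hamiltonian A B L (X s \<omega>) (Z s \<omega>)"

lemma gap_nonneg: "\<omega> \<in> space M \<Longrightarrow> 0 \<le> gap Z s \<omega>"
  using hamiltonian_le[OF X_states] by (simp add: gap_def)

lemma Z_component_H: "adapted M X Z \<Longrightarrow> s \<le> t \<Longrightarrow> (\<lambda>\<omega>. Z s \<omega> $ i) \<in> borel_measurable (H t)"
  for Z :: "nat \<Rightarrow> 'w \<Rightarrow> real ^ 'n"
  unfolding adapted_def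
  by (rule measurable_compose[OF measurable_H_mono borel_measurable_continuous_onI])
     (auto intro!: continuous_intros)

lemma gap_H:
  assumes "adapted M X Z" "s \<le> t"
  shows "gap Z s \<in> borel_measurable (H t)"
proof -
  have "(\<lambda>\<omega>. Z s \<omega> \<bullet> ((B (U s \<omega>) - A) *v X s \<omega>)) \<in> borel_measurable (H t)"
    unfolding matrix_vector_mult_diff_rdistrib inner_vec_def inner_real_def vector_minus_component
    by (intro borel_measurable_sum borel_measurable_times borel_measurable_diff Z_component_H assms BX_measurable
        measurable_H_mono[OF AX_measurable])
  then show ?thesis
    unfolding gap_def by (intro borel_measurable_add borel_measurable_diff cost_H hamiltonian_H assms)
qed

text \<open>The coordinates of \<open>X (Suc s)\<close> are the indicators of the sets
  \<open>ev (Suc s) i\<close>, so the claim splits into jump identities with the coordinates of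
  \<open>Z s\<close> as test functions.\<close>

lemma integral_martingale_increment:
  assumes Z: "adapted M X Z" and "s < T"
  shows "(\<integral>\<omega>. Z s \<omega> \<bullet> (X (Suc s) \<omega> - B (U s \<omega>) *v X s \<omega>) * likelihood U x T \<omega> \<partial>M) = 0"
proof -
  have eq: "Z s \<omega> \<bullet> (X (Suc s) \<omega> - B (U s \<omega>) *v X s \<omega>) * likelihood U x T \<omega>
    = (\<Sum>i\<in>UNIV. Z s \<omega> $ i * indicator (ev (Suc s) i) \<omega> * likelihood U x T \<omega>
        - Z s \<omega> $ i * (B (U s \<omega>) *v X s \<omega>) $ i * likelihood U x T \<omega>)" if "\<omega> \<in> space M" for \<omega>
  proof -
    have "X (Suc s) \<omega> $ i = indicator (ev (Suc s) i) \<omega>" for i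
      using ex_axis[OF X_states[OF that, of "Suc s"]] that by (auto simp: ev_def axis_eq_axis indicator_def axis_def)
    then show ?thesis
      by (simp add: inner_vec_def right_diff_distrib sum_distrib_right left_diff_distrib)
  qed
  have int: "integrable M (\<lambda>\<omega>. Z s \<omega> $ i * indicator (ev (Suc s) i) \<omega> * likelihood U x T \<omega>)"
    "integrable M (\<lambda>\<omega>. Z s \<omega> $ i * (B (U s \<omega>) *v X s \<omega>) $ i * likelihood U x T \<omega>)" for i
    using \<open>s < T\<close> by (intro integrable_H[of _ T] borel_measurable_times Z_component_H[OF Z] BX_measurable
        likelihood_measurable borel_measurable_indicator ev_H; simp)+
  have "(\<integral>\<omega>. Z s \<omega> \<bullet> (X (Suc s) \<omega> - B (U s \<omega>) *v X s \<omega>) * likelihood U x T \<omega> \<partial>M)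
    = (\<integral>\<omega>. (\<Sum>i\<in>UNIV. Z s \<omega> $ i * indicator (ev (Suc s) i) \<omega> * likelihood U x T \<omega>
        - Z s \<omega> $ i * (B (U s \<omega>) *v X s \<omega>) $ i * likelihood U x T \<omega>) \<partial>M)"
    by (rule Bochner_Integration.integral_cong[OF refl eq])
  also have "\<dots> = (\<Sum>i\<in>UNIV. (\<integral>\<omega>. Z s \<omega> $ i * indicator (ev (Suc s) i) \<omega> * likelihood U x T \<omega> \<partial>M)
        - (\<integral>\<omega>. Z s \<omega> $ i * (B (U s \<omega>) *v X s \<omega>) $ i * likelihood U x T \<omega> \<partial>M))"
    using int by simp
  also have "\<dots> = 0"
    using \<open>s < T\<close> by (simp add: integral_likelihood_jump Z_component_H[OF Z])
  finally show ?thesis .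
qed

abbreviation expected_cost :: "nat \<Rightarrow> real" where
  "expected_cost T \<equiv> (\<integral>\<omega>. (\<Sum>s<T. L (X s \<omega>) (U s \<omega>)) \<partial>controlled_law M X B U x T)"

text \<open>An exact identity from which both cost bounds follow. The equation for \<open>Y\<close>
  holds almost surely under \<open>M\<close>, which suffices because expectations under the
  controlled law are \<open>M\<close>-integrals against the density.\<close>

lemma expected_cost_eq:
  assumes sol: "ebsde_solution M X A (hamiltonian A B L) Y Z l" and "0 < T"
  shows "expected_cost T = l * real T + (\<integral>\<omega>. (Y 0 \<omega> - Y T \<omega>) * likelihood U x T \<omega> \<partial>M)
    + (\<integral>\<omega>. (\<Sum>s<T. gap Z s \<omega>) * likelihood U x T \<omega> \<partial>M)"
proof -
  have Y: "adapted M X Y" and Z: "adapted M X Z" using sol by (auto simp: ebsde_solution_def)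
  have YH: "Y s \<in> borel_measurable (H T)" if "s \<le> T" for s
    using Y measurable_H_mono that unfolding adapted_def by blast
  let ?D = "likelihood U x T"
  let ?N = "\<lambda>s \<omega>. Z s \<omega> \<bullet> (X (Suc s) \<omega> - B (U s \<omega>) *v X s \<omega>)"
  have D: "?D \<in> borel_measurable (H T)" by (rule likelihood_measurable) simp
  have NH: "?N s \<in> borel_measurable (H T)" if "s < T" for s
    unfolding inner_vec_def inner_real_def vector_minus_component
    using that by (intro borel_measurable_sum borel_measurable_times borel_measurable_diff
        Z_component_H Z X_component_measurable BX_measurable) auto
  have cH: "(\<lambda>\<omega>. \<Sum>s<T. L (X s \<omega>) (U s \<omega>)) \<in> borel_measurable (H T)"
    by (intro borel_measurable_sum cost_H) simp
  have gH: "(\<lambda>\<omega>. \<Sum>s<T. gap Z s \<omega>) \<in> borel_measurable (H T)"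
    by (intro borel_measurable_sum gap_H Z) simp
  have int1: "integrable M (\<lambda>\<omega>. (Y 0 \<omega> - Y T \<omega>) * ?D \<omega>)"
    by (intro integrable_H[of _ T] borel_measurable_times borel_measurable_diff YH D) simp_all
  have int2: "integrable M (\<lambda>\<omega>. (\<Sum>s<T. gap Z s \<omega>) * ?D \<omega>)"
    by (intro integrable_H[of _ T] borel_measurable_times gH D)
  have int3: "integrable M (\<lambda>\<omega>. ?N s \<omega> * ?D \<omega>)" if "s < T" for s
    by (intro integrable_H[of _ T] borel_measurable_times NH D that)
  have int4: "integrable M (\<lambda>\<omega>. \<Sum>s<T. ?N s \<omega> * ?D \<omega>)"
    by (intro Bochner_Integration.integrable_sum int3) simp
  have int5: "(\<integral>\<omega>. (\<Sum>s<T. ?N s \<omega> * ?D \<omega>) \<partial>M) = (\<Sum>s<T. \<integral>\<omega>. ?N s \<omega> * ?D \<omega> \<partial>M)"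
    by (intro Bochner_Integration.integral_sum int3) simp
  have int0: "integrable M ?D" by (rule integrable_H[OF D])
  have "AE \<omega> in M. \<forall>t T. t < T \<longrightarrow> Y T \<omega> = Y t \<omega> - (\<Sum>u\<in>{t..<T}. hamiltonian A B L (X u \<omega>) (Z u \<omega>) - l)
      + (\<Sum>u\<in>{t..<T}. Z u \<omega> \<bullet> (X (Suc u) \<omega> - A *v X u \<omega>))"
    using sol by (simp add: ebsde_solution_def)
  then have ae: "AE \<omega> in M. (\<Sum>s<T. L (X s \<omega>) (U s \<omega>)) * ?D \<omega> = l * real T * ?D \<omega>
      + (Y 0 \<omega> - Y T \<omega>) * ?D \<omega> + (\<Sum>s<T. gap Z s \<omega>) * ?D \<omega> + (\<Sum>s<T. ?N s \<omega> * ?D \<omega>)"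
  proof eventually_elim
    case (elim \<omega>)
    from elim[rule_format, OF \<open>0 < T\<close>]
    have YT: "Y T \<omega> = Y 0 \<omega> - (\<Sum>u<T. hamiltonian A B L (X u \<omega>) (Z u \<omega>) - l)
      + (\<Sum>u<T. Z u \<omega> \<bullet> (X (Suc u) \<omega> - A *v X u \<omega>))"
      by (simp add: lessThan_atLeast0)
    \<comment> \<open>The term with \<open>B (U s \<omega>) - A\<close> inside \<open>gap\<close>
      converts the increment around \<open>A *v X s \<omega>\<close> into
      \<open>?N s \<omega>\<close>, which has mean zero under the controlled law.\<close>
    have "L (X s \<omega>) (U s \<omega>) = (hamiltonian A B L (X s \<omega>) (Z s \<omega>) - l)
        - Z s \<omega> \<bullet> (X (Suc s) \<omega> - A *v X s \<omega>) + l + gap Z s \<omega> + ?N s \<omega>" for s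
      by (simp add: gap_def matrix_vector_mult_diff_rdistrib inner_diff_right)
    then have "(\<Sum>s<T. L (X s \<omega>) (U s \<omega>)) = (\<Sum>s<T. hamiltonian A B L (X s \<omega>) (Z s \<omega>) - l)
        - (\<Sum>s<T. Z s \<omega> \<bullet> (X (Suc s) \<omega> - A *v X s \<omega>)) + real T * l
        + (\<Sum>s<T. gap Z s \<omega>) + (\<Sum>s<T. ?N s \<omega>)"
      by (simp only: sum.distrib sum_subtractf sum_constant card_lessThan)
    then have "(\<Sum>s<T. L (X s \<omega>) (U s \<omega>)) = l * real T
      + (Y 0 \<omega> - Y T \<omega>) + (\<Sum>s<T. gap Z s \<omega>) + (\<Sum>s<T. ?N s \<omega>)"
      using YT by (simp only: mult.commute[of l])
    then show ?case
      by (simp only: distrib_right sum_distrib_right)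
  qed
  have "expected_cost T = (\<integral>\<omega>. (\<Sum>s<T. L (X s \<omega>) (U s \<omega>)) * ?D \<omega> \<partial>M)"
    unfolding controlled_law_eq by (rule integral_law[OF cH])
  also have "\<dots> = (\<integral>\<omega>. l * real T * ?D \<omega>
      + (Y 0 \<omega> - Y T \<omega>) * ?D \<omega> + (\<Sum>s<T. gap Z s \<omega>) * ?D \<omega> + (\<Sum>s<T. ?N s \<omega> * ?D \<omega>) \<partial>M)"
  proof (rule integral_cong_AE[OF _ _ ae])
    show "(\<lambda>\<omega>. (\<Sum>s<T. L (X s \<omega>) (U s \<omega>)) * ?D \<omega>) \<in> borel_measurable M"
      by (intro measurable_H_M[of _ T] borel_measurable_times cH D)
    show "(\<lambda>\<omega>. l * real T * ?D \<omega> + (Y 0 \<omega> - Y T \<omega>) * ?D \<omega> + (\<Sum>s<T. gap Z s \<omega>) * ?D \<omega>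
        + (\<Sum>s<T. ?N s \<omega> * ?D \<omega>)) \<in> borel_measurable M"
      using int0 int1 int2 int4 by (intro borel_measurable_add) auto
  qed
  also have "\<dots> = l * real T * (\<integral>\<omega>. ?D \<omega> \<partial>M) + (\<integral>\<omega>. (Y 0 \<omega> - Y T \<omega>) * ?D \<omega> \<partial>M)
      + (\<integral>\<omega>. (\<Sum>s<T. gap Z s \<omega>) * ?D \<omega> \<partial>M) + (\<Sum>s<T. \<integral>\<omega>. ?N s \<omega> * ?D \<omega> \<partial>M)"
    by (simp add: int0 int1 int2 int4 int5)
  also have "(\<Sum>s<T. \<integral>\<omega>. ?N s \<omega> * ?D \<omega> \<partial>M) = 0"
    by (simp add: integral_martingale_increment[OF Z])
  finally show ?thesis by (simp add: integral_likelihood)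
qed

lemma integral_likelihood_le:
  assumes g: "g \<in> borel_measurable (H T)" and "AE \<omega> in M. g \<omega> \<le> c"
  shows "(\<integral>\<omega>. g \<omega> * likelihood U x T \<omega> \<partial>M) \<le> c"
proof -
  have D: "likelihood U x T \<in> borel_measurable (H T)" by (rule likelihood_measurable) simp
  have "(\<integral>\<omega>. g \<omega> * likelihood U x T \<omega> \<partial>M) \<le> (\<integral>\<omega>. c * likelihood U x T \<omega> \<partial>M)"
  proof (rule integral_mono_AE)
    show "AE \<omega> in M. g \<omega> * likelihood U x T \<omega> \<le> c * likelihood U x T \<omega>"
      using assms(2) AE_likelihood_nonneg[of T] by eventually_elim (rule mult_right_mono)
  qed (auto intro!: integrable_H[of _ T] borel_measurable_times g D)
  then show ?thesis by (simp add: integral_likelihood)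
qed

lemma integral_likelihood_ge:
  assumes g: "g \<in> borel_measurable (H T)" and "AE \<omega> in M. c \<le> g \<omega>"
  shows "c \<le> (\<integral>\<omega>. g \<omega> * likelihood U x T \<omega> \<partial>M)"
  using integral_likelihood_le[of "\<lambda>\<omega>. - g \<omega>" T "- c"] assms by simp

lemma integral_Y_bound:
  assumes "ebsde_solution M X A f Y Z l" and C: "AE \<omega> in M. \<forall>t. \<bar>Y t \<omega>\<bar> \<le> C"
  shows "\<bar>\<integral>\<omega>. (Y 0 \<omega> - Y T \<omega>) * likelihood U x T \<omega> \<partial>M\<bar> \<le> 2 * C"
proof -
  have YH: "Y s \<in> borel_measurable (H T)" if "s \<le> T" for s
    using assms(1) measurable_H_mono that unfolding adapted_def ebsde_solution_def by blast
  have *: "(\<lambda>\<omega>. Y 0 \<omega> - Y T \<omega>) \<in> borel_measurable (H T)"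
    by (intro borel_measurable_diff YH) simp_all
  have b: "AE \<omega> in M. \<bar>Y 0 \<omega> - Y T \<omega>\<bar> \<le> 2 * C"
    using C
  proof eventually_elim
    case (elim \<omega>)
    from elim[rule_format, of 0] elim[rule_format, of T] show ?case by linarith
  qed
  have "AE \<omega> in M. Y 0 \<omega> - Y T \<omega> \<le> 2 * C"
    using b by eventually_elim simp
  moreover have "AE \<omega> in M. - (2 * C) \<le> Y 0 \<omega> - Y T \<omega>"
    using b by eventually_elim (simp add: abs_le_iff)
  ultimately show ?thesis
    using integral_likelihood_le[OF *, of "2 * C"] integral_likelihood_ge[OF *, of "- (2 * C)"]
    by linarith
qed

lemma ergodic_cost_ge:
  assumes sol: "ebsde_solution M X A (hamiltonian A B L) Y Z l" and "bounded_process M Y"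
  shows "ereal l \<le> ergodic_cost M X B L x U"
proof -
  obtain C where C: "AE \<omega> in M. \<forall>t. \<bar>Y t \<omega>\<bar> \<le> C"
    using assms(2) unfolding bounded_process_def by (elim exE)
  have Z: "adapted M X Z" using sol by (simp add: ebsde_solution_def)
  \<comment> \<open>\<open>2 * C\<close> bounds the boundary term
    \<open>Y 0 \<omega> - Y T \<omega>\<close> and disappears after division by the horizon.\<close>
  have lim: "(\<lambda>T. l - 2 * C / real T) \<longlonglongrightarrow> l" by real_asymp
  have "l - 2 * C / real T \<le> 1 / real T * expected_cost T" if "0 < T" for T
  proof -
    have "0 \<le> (\<integral>\<omega>. (\<Sum>s<T. gap Z s \<omega>) * likelihood U x T \<omega> \<partial>M)"
      by (intro integral_likelihood_ge borel_measurable_sum gap_H Z AE_I2 sum_nonneg gap_nonneg) simp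
    then have "l * real T - 2 * C \<le> expected_cost T"
      using integral_Y_bound[OF sol C, of T] expected_cost_eq[OF sol that] by linarith
    then have "1 / real T * (l * real T - 2 * C) \<le> 1 / real T * expected_cost T"
      by (rule mult_left_mono) simp
    then show ?thesis using that by (simp add: right_diff_distrib)
  qed
  then have "limsup (\<lambda>T. ereal (l - 2 * C / real T)) \<le> ergodic_cost M X B L x U"
    unfolding ergodic_cost_def by (intro Limsup_mono) (auto intro!: eventually_sequentiallyI[of 1])
  moreover have "limsup (\<lambda>T. ereal (l - 2 * C / real T)) = ereal l"
    using lim by (intro lim_imp_Limsup) simp_all
  ultimately show ?thesis by simp
qed

text \<open>The geometric rate is one convenient summable choice. It covers exact minimizers, whose
  gaps vanish, as well as the approximate ones built below.\<close>

lemma ergodic_cost_eq: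
  assumes sol: "ebsde_solution M X A (hamiltonian A B L) Y Z l" and "bounded_process M Y"
    and gap: "\<And>s. AE \<omega> in M. gap Z s \<omega> \<le> (1 / 2) ^ s"
  shows "ergodic_cost M X B L x U = ereal l"
proof (rule antisym[OF _ ergodic_cost_ge[OF assms(1,2)]])
  obtain C where C: "AE \<omega> in M. \<forall>t. \<bar>Y t \<omega>\<bar> \<le> C"
    using assms(2) unfolding bounded_process_def by (elim exE)
  have Z: "adapted M X Z" using sol by (simp add: ebsde_solution_def)
  \<comment> \<open>Here \<open>2 * C\<close> again comes from the boundary term and the added 2
    from the geometric series that bounds the gaps.\<close>
  have lim: "(\<lambda>T. l + (2 * C + 2) / real T) \<longlonglongrightarrow> l" by real_asymp
  have gap_sum: "AE \<omega> in M. (\<Sum>s<T. gap Z s \<omega>) \<le> 2" for T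
  proof -
    have "AE \<omega> in M. \<forall>s. gap Z s \<omega> \<le> (1 / 2) ^ s"
      using gap by (simp add: AE_all_countable)
    then show ?thesis
    proof eventually_elim
      case (elim \<omega>)
      then have "(\<Sum>s<T. gap Z s \<omega>) \<le> (\<Sum>s<T. (1 / 2) ^ s)" by (intro sum_mono) simp
      also have "\<dots> \<le> 2" by (simp add: sum_gp_strict)
      finally show ?case .
    qed
  qed
  have "1 / real T * expected_cost T \<le> l + (2 * C + 2) / real T" if "0 < T" for T
  proof -
    have "(\<integral>\<omega>. (\<Sum>s<T. gap Z s \<omega>) * likelihood U x T \<omega> \<partial>M) \<le> 2"
      by (intro integral_likelihood_le borel_measurable_sum gap_H Z gap_sum) simp
    then have "expected_cost T \<le> l * real T + (2 * C + 2)"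
      using integral_Y_bound[OF sol C, of T] expected_cost_eq[OF sol that] by linarith
    then have "1 / real T * expected_cost T \<le> 1 / real T * (l * real T + (2 * C + 2))"
      by (rule mult_left_mono) simp
    then show ?thesis using that by (simp add: distrib_left add_divide_distrib)
  qed
  then have "ergodic_cost M X B L x U \<le> limsup (\<lambda>T. ereal (l + (2 * C + 2) / real T))"
    unfolding ergodic_cost_def by (intro Limsup_mono) (auto intro!: eventually_sequentiallyI[of 1])
  also have "limsup (\<lambda>T. ereal (l + (2 * C + 2) / real T)) = ereal l"
    using lim by (intro lim_imp_Limsup) simp_all
  finally show "ergodic_cost M X B L x U \<le> ereal l" .
qed

lemma ergodic_cost_eq_optimal:
  assumes "ebsde_solution M X A (hamiltonian A B L) Y Z l" "bounded_process M Y"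
    and opt: "AE \<omega> in M. \<forall>s. hamiltonian A B L (X s \<omega>) (Z s \<omega>) =
      L (X s \<omega>) (U s \<omega>) + Z s \<omega> \<bullet> ((B (U s \<omega>) - A) *v X s \<omega>)"
  shows "ergodic_cost M X B L x U = ereal l"
proof (rule ergodic_cost_eq[OF assms(1,2)])
  show "AE \<omega> in M. gap Z s \<omega> \<le> (1 / 2) ^ s" for s
    using opt by eventually_elim (simp add: gap_def)
qed

end

section \<open>Optimal and nearly optimal controls\<close>

text \<open>Take complements in \<open>K\<close> of small balls around finite nets: once the radius
  is below half the distance of \<open>u\<close> and \<open>v\<close>, a ball containing
  \<open>u\<close> misses \<open>v\<close>.\<close>

lemma compact_metrizable_separating_closed:
  fixes K :: "'u::topological_space set"
  assumes "compact K" and "metrizable_space (top_of_set K)"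
  obtains E :: "nat \<Rightarrow> 'u set"
  where "\<And>n. closedin (top_of_set K) (E n)"
    and "\<And>u v. u \<in> K \<Longrightarrow> v \<in> K \<Longrightarrow> u \<noteq> v \<Longrightarrow> \<exists>n. v \<in> E n \<and> u \<notin> E n"
proof -
  obtain S d where S: "Metric_space S d" and top: "top_of_set K = Metric_space.mtopology S d"
    using assms(2) unfolding metrizable_space_def by blast
  interpret Metric_space S d by fact
  have SK: "S = K" using topspace_mtopology top by (metis topspace_euclidean_subtopology)
  have "compactin mtopology K"
    using assms(1) by (simp add: compactin_subtopology flip: top)
  then have "mtotally_bounded K" by (rule compactin_imp_mtotally_bounded)
  then have "\<exists>N. finite N \<and> N \<subseteq> K \<and> K \<subseteq> (\<Union>x\<in>N. mball x (1 / real (Suc n)))" for n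
    unfolding mtotally_bounded_def by simp
  then obtain N where N: "\<And>n. finite (N n)" "\<And>n. K \<subseteq> (\<Union>x\<in>N n. mball x (1 / real (Suc n)))"
    by metis
  \<comment> \<open>\<open>K\<close> itself is included so that the family is nonempty, hence
    enumerable by \<open>from_nat_into\<close>, even for empty \<open>K\<close>.\<close>
  let ?\<E> = "insert K (\<Union>n. (\<lambda>x. K - mball x (1 / real (Suc n))) ` N n)"
  have "countable ?\<E>"
    by (intro countable_insert countable_UN countable_image countable_finite[OF N(1)]) simp
  then have range: "range (from_nat_into ?\<E>) = ?\<E>"
    by (intro range_from_nat_into) auto
  have closed: "closedin (top_of_set K) C" if "C \<in> ?\<E>" for C
  proof -
    have topspace: "topspace mtopology = K" by (rule trans[OF topspace_mtopology SK])
    have "closedin mtopology (K - mball x r)" for x r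
      using closedin_diff[OF closedin_topspace openin_mball, of x r] unfolding topspace .
    moreover have "closedin mtopology K"
      using closedin_topspace[of mtopology] unfolding topspace .
    ultimately show ?thesis using that unfolding top by blast
  qed
  show ?thesis
  proof (rule that[of "from_nat_into ?\<E>"])
    show "closedin (top_of_set K) (from_nat_into ?\<E> n)" for n
      by (rule closed[OF from_nat_into]) simp
    fix u v assume uv: "u \<in> K" "v \<in> K" "u \<noteq> v"
    then have "0 < d u v" using SK by (simp add: mdist_pos_less)
    then obtain n where n: "1 / real (Suc n) < d u v / 2"
      using nat_approx_posE[of "d u v / 2"] by auto
    obtain x where x: "x \<in> N n" "u \<in> mball x (1 / real (Suc n))"
      using N(2)[of n] uv(1) by blast
    have "v \<notin> mball x (1 / real (Suc n))"
    proof
      assume "v \<in> mball x (1 / real (Suc n))"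
      then have "d u v \<le> d x u + d x v" "d x u < 1 / real (Suc n)" "d x v < 1 / real (Suc n)"
        using x(2) triangle[of u x v] by (auto simp: commute)
      with n show False by linarith
    qed
    then have vu: "v \<in> K - mball x (1 / real (Suc n))" "u \<notin> K - mball x (1 / real (Suc n))"
      using x uv by simp_all
    have "K - mball x (1 / real (Suc n)) \<in> range (from_nat_into ?\<E>)"
      unfolding range using x(1) by blast
    then obtain m where m: "from_nat_into ?\<E> m = K - mball x (1 / real (Suc n))"
      by (rule imageE) simp
    show "\<exists>n. v \<in> from_nat_into ?\<E> n \<and> u \<notin> from_nat_into ?\<E> n"
      using vu by (intro exI[of _ m]) (simp only: m simp_thms)
  qed
qed

text \<open>A cut that would leave nothing is skipped, so a nonempty set stays nonempty at every
  stage.\<close>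

primrec refine_by :: "(nat \<Rightarrow> 'u set) \<Rightarrow> 'u set \<Rightarrow> nat \<Rightarrow> 'u set" where
  "refine_by E S 0 = S"
| "refine_by E S (Suc n) = (if refine_by E S n \<inter> E n = {} then refine_by E S n else refine_by E S n \<inter> E n)"

text \<open>Cutting a closed set down by each member of a countable separating family in turn
  leaves a single point, whose membership in a closed set is decided by the finite stages.\<close>

lemma measurable_selection:
  fixes \<Gamma> :: "'z \<Rightarrow> 'u::topological_space set"
  assumes "compact K" and "metrizable_space (top_of_set K)"
    and \<Gamma>: "\<And>z. z \<in> space N \<Longrightarrow> closedin (top_of_set K) (\<Gamma> z)"
    and hit: "\<And>C. closedin (top_of_set K) C \<Longrightarrow> {z \<in> space N. \<Gamma> z \<inter> C \<noteq> {}} \<in> sets N"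
  shows "\<exists>s\<in>N \<rightarrow>\<^sub>M borel. \<forall>z\<in>space N. \<Gamma> z \<noteq> {} \<longrightarrow> s z \<in> \<Gamma> z"
proof -
  obtain E :: "nat \<Rightarrow> 'u set" where E: "\<And>n. closedin (top_of_set K) (E n)"
    and sep: "\<And>u v. u \<in> K \<Longrightarrow> v \<in> K \<Longrightarrow> u \<noteq> v \<Longrightarrow> \<exists>n. v \<in> E n \<and> u \<notin> E n"
    using compact_metrizable_separating_closed[OF assms(1,2)] by metis
  define G where "G z = refine_by E (\<Gamma> z)" for z
  have G0: "G z 0 = \<Gamma> z" and GSuc: "G z (Suc n) = (if G z n \<inter> E n = {} then G z n else G z n \<inter> E n)" for z n
    by (simp_all add: G_def)
  have G_closed: "closedin (top_of_set K) (G z n)" if "z \<in> space N" for z n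
    by (induction n) (auto simp: G0 GSuc \<Gamma>[OF that] intro: closedin_Int E)
  have G_ne: "G z n \<noteq> {}" if "\<Gamma> z \<noteq> {}" for z n
    by (induction n) (auto simp: G0 GSuc that)
  have G_dec: "decseq (G z)" for z
    by (rule decseq_SucI) (auto simp: GSuc)
  have G_hit: "{z \<in> space N. G z n \<inter> C \<noteq> {}} \<in> sets N" if "closedin (top_of_set K) C" for C n
    using that
  proof (induction n arbitrary: C)
    case 0
    then show ?case using hit by (simp add: G0)
  next
    case (Suc n)
    \<comment> \<open>Either the cut is made and stage \<open>n\<close> must meet
      \<open>E n \<inter> C\<close>, or it is skipped because stage \<open>n\<close> misses
      \<open>E n\<close>. Both conditions concern stage \<open>n\<close> only.\<close>
    have "{z \<in> space N. G z (Suc n) \<inter> C \<noteq> {}} = {z \<in> space N. G z n \<inter> (E n \<inter> C) \<noteq> {}}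
        \<union> ({z \<in> space N. G z n \<inter> C \<noteq> {}} - {z \<in> space N. G z n \<inter> E n \<noteq> {}})"
      by (auto simp: GSuc)
    moreover have "{z \<in> space N. G z n \<inter> (E n \<inter> C) \<noteq> {}} \<in> sets N"
      by (rule Suc.IH) (rule closedin_Int[OF E Suc.prems])
    ultimately show ?case
      using Suc.IH[OF Suc.prems] Suc.IH[OF E] by (simp add: sets.Un sets.Diff)
  qed
  have nest: "(\<Inter>n. G z n \<inter> C) \<noteq> {}"
    if "z \<in> space N" "closedin (top_of_set K) C" "\<And>n. G z n \<inter> C \<noteq> {}" for z C
  proof (rule compact_space_imp_nest)
    show "compact_space (top_of_set K)" using assms(1) by (simp add: compact_space_subtopology)
    show "closedin (top_of_set K) (G z n \<inter> C)" for n
      using that G_closed by (intro closedin_Int) auto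
    show "decseq (\<lambda>n. G z n \<inter> C)"
      using G_dec[of z] by (auto simp: decseq_def)
  qed fact
  \<comment> \<open>If \<open>E n\<close> contains \<open>v\<close> but not \<open>u\<close>, then
    \<open>v\<close> keeps the cut at stage \<open>n\<close> nonempty; so the cut was made and
    removed \<open>u\<close>.\<close>
  have single: "u = v" if z: "z \<in> space N" and u: "\<And>n. u \<in> G z n" and v: "\<And>n. v \<in> G z n" for z u v
  proof (rule ccontr)
    assume "u \<noteq> v"
    moreover have "u \<in> K" "v \<in> K" using u[of 0] v[of 0] closedin_subset[OF G_closed[OF z, of 0]] by auto
    ultimately obtain n where "v \<in> E n" "u \<notin> E n" using sep by blast
    with u[of "Suc n"] v[of n] show False by (auto simp: GSuc split: if_splits)
  qed
  \<comment> \<open>A constant default on empty values contributes to a preimage all or none of the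
    measurable set where \<open>\<Gamma> z\<close> is empty.\<close>
  define s where "s z = (if \<Gamma> z = {} then undefined else SOME u. \<forall>n. u \<in> G z n)" for z
  have s: "s z \<in> G z n" if "z \<in> space N" "\<Gamma> z \<noteq> {}" for z n
  proof -
    have "closedin (top_of_set K) K" by simp
    moreover have "G z n \<inter> K = G z n" for n
      using closedin_subset[OF G_closed[OF that(1), of n]] by auto
    ultimately have "(\<Inter>n. G z n) \<noteq> {}" using nest[OF that(1), of K] G_ne[OF that(2)] by simp
    then have "\<exists>u. \<forall>n. u \<in> G z n" by auto
    from someI_ex[OF this] show ?thesis using that(2) by (simp add: s_def)
  qed
  have "s \<in> N \<rightarrow>\<^sub>M borel"
  proof (rule borel_measurableI)
    fix W :: "'u set" assume "open W"
    then have C: "closedin (top_of_set K) (K \<inter> - W)"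
      by (intro closedin_closed_Int) (simp add: closed_Compl)
    have ne: "{z \<in> space N. \<Gamma> z \<noteq> {}} \<in> sets N"
    proof -
      have "{z \<in> space N. \<Gamma> z \<noteq> {}} = {z \<in> space N. \<Gamma> z \<inter> K \<noteq> {}}"
        using closedin_subset[OF \<Gamma>] by fastforce
      then show ?thesis using hit[of K] by simp
    qed
    have iff: "s z \<notin> W \<longleftrightarrow> (\<forall>n. G z n \<inter> (K \<inter> - W) \<noteq> {})" if z: "z \<in> space N" "\<Gamma> z \<noteq> {}" for z
    proof
      assume "s z \<notin> W"
      then show "\<forall>n. G z n \<inter> (K \<inter> - W) \<noteq> {}"
        using s[OF z] closedin_subset[OF G_closed[OF z(1)]] by fastforce
    next
      assume "\<forall>n. G z n \<inter> (K \<inter> - W) \<noteq> {}"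
      then obtain u where "\<And>n. u \<in> G z n \<inter> (K \<inter> - W)"
        using nest[OF z(1) C] by blast
      then show "s z \<notin> W" using single[OF z(1), of u "s z"] s[OF z] by blast
    qed
    have undef: "s z = undefined" if "\<Gamma> z = {}" for z using that by (simp add: s_def)
    have "s -` W \<inter> space N = ({z \<in> space N. \<Gamma> z \<noteq> {}} - (\<Inter>n. {z \<in> space N. G z n \<inter> (K \<inter> - W) \<noteq> {}}))
        \<union> (if undefined \<in> W then space N - {z \<in> space N. \<Gamma> z \<noteq> {}} else {})"
    proof (rule set_eqI)
      show "z \<in> s -` W \<inter> space N \<longleftrightarrow> z \<in> ({z \<in> space N. \<Gamma> z \<noteq> {}} - (\<Inter>n. {z \<in> space N. G z n \<inter> (K \<inter> - W) \<noteq> {}}))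
        \<union> (if undefined \<in> W then space N - {z \<in> space N. \<Gamma> z \<noteq> {}} else {})" for z
        using iff[of z] undef[of z] by (cases "\<Gamma> z = {}") auto
    qed
    moreover have "(\<Inter>n. {z \<in> space N. G z n \<inter> (K \<inter> - W) \<noteq> {}}) \<in> sets N"
      using G_hit[OF C] by (intro sets.countable_INT) auto
    ultimately show "s -` W \<inter> space N \<in> sets N"
      using ne by auto
  qed
  moreover have "\<forall>z\<in>space N. \<Gamma> z \<noteq> {} \<longrightarrow> s z \<in> \<Gamma> z"
    using s[of _ 0] by (simp add: G0)
  ultimately show ?thesis by blast
qed

section \<open>Measurable minimizers and approximate minimizers\<close>

context controlled_chain
begin

abbreviation reward :: "'n \<Rightarrow> real ^ 'n \<Rightarrow> 'u \<Rightarrow> real" where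
  "reward j z u \<equiv> L (axis j 1) u + z \<bullet> ((B u - A) *v axis j 1)"

lemma continuous_reward: "continuous_on S (reward j z)"
proof -
  have "continuous_on UNIV (reward j z)"
    unfolding inner_transition_axis vector_minus_component
    by (intro continuous_intros L_continuous B_continuous) simp
  then show ?thesis by (rule continuous_on_subset) simp
qed

text \<open>On a nonempty compact set the infimum is attained, so having a minimizer in
  \<open>C\<close> is an inequality between two continuous functions of \<open>z\<close>. Since
  \<open>hamiltonian_le\<close> gives the converse inequality, these points are exact
  minimizers.\<close>

lemma closed_reward_le:
  assumes "compact C"
  shows "closed {z. \<exists>u\<in>C. reward j z u \<le> hamiltonian A B L (axis j 1) z}"
proof (cases "C = {}")
  case False
  have "(\<exists>u\<in>C. reward j z u \<le> h) \<longleftrightarrow> (INF u\<in>C. reward j z u) \<le> h" for z h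
  proof
    assume "\<exists>u\<in>C. reward j z u \<le> h"
    then show "(INF u\<in>C. reward j z u) \<le> h"
      using cINF_lower2[OF bdd_below_hamiltonian] by blast
  next
    assume le: "(INF u\<in>C. reward j z u) \<le> h"
    obtain u where u: "u \<in> C" "\<And>v. v \<in> C \<Longrightarrow> reward j z u \<le> reward j z v"
      using continuous_attains_inf[OF assms False continuous_reward] by blast
    then have "reward j z u \<le> (INF u\<in>C. reward j z u)"
      by (intro cINF_greatest False)
    with le u(1) show "\<exists>u\<in>C. reward j z u \<le> h" by (meson order_trans)
  qed
  then show ?thesis
    by (simp only:) (intro closed_Collect_le continuous_INF_hamiltonian continuous_hamiltonian False)
qed simp

text \<open>\<open>measurable_selection\<close> works inside one compact metrizable set, so it is
  applied in each \<open>K n\<close>, and the value at \<open>z\<close> is taken from the first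
  \<open>K n\<close> that contains a minimizer.\<close>

lemma minimizer_measurable:
  fixes K :: "nat \<Rightarrow> 'u set"
  assumes K: "\<And>n. compact (K n)" "\<And>n. metrizable_space (top_of_set (K n))" "(\<Union>n. K n) = UNIV"
    and attained: "\<And>z. \<exists>u. hamiltonian A B L (axis j 1) z = reward j z u"
  shows "\<exists>\<kappa>\<in>borel \<rightarrow>\<^sub>M borel. \<forall>z. hamiltonian A B L (axis j 1) z = reward j z (\<kappa> z)"
proof -
  define \<Gamma> where "\<Gamma> n z = {u \<in> K n. reward j z u \<le> hamiltonian A B L (axis j 1) z}" for n z
  have hit: "{z \<in> space borel. \<Gamma> n z \<inter> C \<noteq> {}} \<in> sets borel" if C: "closedin (top_of_set (K n)) C" for n C
  proof -
    have "{z \<in> space borel. \<Gamma> n z \<inter> C \<noteq> {}} = {z. \<exists>u\<in>C. reward j z u \<le> hamiltonian A B L (axis j 1) z}"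
      using closedin_subset[OF C] by (auto simp: \<Gamma>_def)
    then show ?thesis using closed_reward_le[OF closedin_compact[OF K(1) C]] by simp
  qed
  have "\<exists>s\<in>borel \<rightarrow>\<^sub>M borel. \<forall>z\<in>space borel. \<Gamma> n z \<noteq> {} \<longrightarrow> s z \<in> \<Gamma> n z" for n
  proof (rule measurable_selection[OF K(1,2) _ hit])
    have "\<Gamma> n z = K n \<inter> reward j z -` {..hamiltonian A B L (axis j 1) z}" for z
      by (auto simp: \<Gamma>_def)
    then show "closedin (top_of_set (K n)) (\<Gamma> n z)" for z
      by (simp add: continuous_closedin_preimage[OF continuous_reward])
  qed
  then obtain s where s: "\<And>n. s n \<in> borel \<rightarrow>\<^sub>M borel" "\<And>n z. \<Gamma> n z \<noteq> {} \<Longrightarrow> s n z \<in> \<Gamma> n z"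
    by (metis UNIV_I space_borel)
  have ex: "\<exists>n. \<Gamma> n z \<noteq> {}" for z
  proof -
    obtain u where "hamiltonian A B L (axis j 1) z = reward j z u" using attained by blast
    moreover obtain n where "u \<in> K n" using K(3) by blast
    ultimately show ?thesis by (auto simp: \<Gamma>_def intro!: exI[of _ n])
  qed
  have "Measurable.pred borel (\<lambda>z. \<Gamma> n z \<noteq> {})" for n
  proof -
    have "\<Gamma> n z \<inter> K n = \<Gamma> n z" for z by (auto simp: \<Gamma>_def)
    then show ?thesis using hit[of n "K n"] by (simp add: pred_def)
  qed
  then have "(\<lambda>z. LEAST n. \<Gamma> n z \<noteq> {}) \<in> borel \<rightarrow>\<^sub>M count_space UNIV"
    by (rule measurable_Least)
  from measurable_compose_countable[OF s(1) this]
  have "(\<lambda>z. s (LEAST n. \<Gamma> n z \<noteq> {}) z) \<in> borel \<rightarrow>\<^sub>M borel" .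
  moreover have "hamiltonian A B L (axis j 1) z = reward j z (s (LEAST n. \<Gamma> n z \<noteq> {}) z)" for z
  proof (rule antisym[OF hamiltonian_le])
    have "\<Gamma> (LEAST n. \<Gamma> n z \<noteq> {}) z \<noteq> {}" using ex by (rule LeastI_ex)
    then show "reward j z (s (LEAST n. \<Gamma> n z \<noteq> {}) z) \<le> hamiltonian A B L (axis j 1) z"
      using s(2) by (simp add: \<Gamma>_def)
  qed simp
  ultimately show ?thesis
    by (intro bexI[of _ "\<lambda>z. s (LEAST n. \<Gamma> n z \<noteq> {}) z"] allI)
qed

lemma minimizing_selector_exists:
  fixes K :: "nat \<Rightarrow> 'u set"
  assumes K: "\<And>n. compact (K n)" "\<And>n. metrizable_space (top_of_set (K n))" "(\<Union>n. K n) = UNIV"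
    and attained: "\<And>x z. x \<in> states \<Longrightarrow> \<exists>u. hamiltonian A B L x z = L x u + z \<bullet> ((B u - A) *v x)"
  shows "\<exists>\<kappa>. minimizing_selector A B L \<kappa>"
proof -
  have "\<exists>k\<in>borel \<rightarrow>\<^sub>M borel. \<forall>z. hamiltonian A B L x z = L x (k z) + z \<bullet> ((B (k z) - A) *v x)"
    if "x \<in> states" for x
  proof -
    obtain j where "x = axis j 1" using \<open>x \<in> states\<close> by (rule statesE)
    then show ?thesis using minimizer_measurable[OF K, of j] attained by simp
  qed
  then obtain \<kappa> where \<kappa>: "\<And>x. x \<in> states \<Longrightarrow> \<kappa> x \<in> borel \<rightarrow>\<^sub>M borel"
    "\<And>x z. x \<in> states \<Longrightarrow> hamiltonian A B L x z = L x (\<kappa> x z) + z \<bullet> ((B (\<kappa> x z) - A) *v x)"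
    by metis
  have "(\<lambda>(x, z). \<kappa> x z) \<in> restrict_space borel states \<Otimes>\<^sub>M borel \<rightarrow>\<^sub>M borel"
  proof (rule borel_measurableI)
    fix W :: "'u set" assume W: "open W"
    \<comment> \<open>With finitely many states the preimage is a finite union of rectangles, so
      measurability of each section suffices.\<close>
    have "(\<lambda>(x, z). \<kappa> x z) -` W \<inter> space (restrict_space borel states \<Otimes>\<^sub>M borel)
        = (\<Union>x\<in>states. {x} \<times> (\<kappa> x -` W))"
      by (auto simp: space_pair_measure space_restrict_space)
    also have "\<dots> \<in> sets (restrict_space borel states \<Otimes>\<^sub>M borel)"
    proof (rule sets.finite_UN[OF finite_states])
      fix x :: "real ^ 'n" assume x: "x \<in> states"
      have "{x} \<in> sets (restrict_space borel states)"
        using x by (subst sets_restrict_space_iff) (auto simp: finite_states borel_closed finite_imp_closed)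
      moreover have "\<kappa> x -` W \<in> sets borel"
        using measurable_sets[OF \<kappa>(1)[OF x], of W] W by simp
      ultimately show "{x} \<times> (\<kappa> x -` W) \<in> sets (restrict_space borel states \<Otimes>\<^sub>M borel)"
        by (rule pair_measureI)
    qed
    finally show "(\<lambda>(x, z). \<kappa> x z) -` W \<inter> space (restrict_space borel states \<Otimes>\<^sub>M borel)
        \<in> sets (restrict_space borel states \<Otimes>\<^sub>M borel)" .
  qed
  with \<kappa>(2) show ?thesis unfolding minimizing_selector_def by blast
qed

lemma minimizing_selector_adapted:
  assumes \<kappa>: "minimizing_selector A B L \<kappa>" and Z: "adapted M X Z"
  shows "adapted M X (\<lambda>t \<omega>. \<kappa> (X t \<omega>) (Z t \<omega>))"
  unfolding adapted_def
proof
  fix t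
  have "X t \<in> H t \<rightarrow>\<^sub>M restrict_space borel states"
    by (rule measurable_restrict_space2) (auto intro: X_H X_states)
  moreover have "Z t \<in> H t \<rightarrow>\<^sub>M borel" using Z by (simp add: adapted_def)
  ultimately have "(\<lambda>\<omega>. (X t \<omega>, Z t \<omega>)) \<in> H t \<rightarrow>\<^sub>M restrict_space borel states \<Otimes>\<^sub>M borel"
    by (rule measurable_Pair)
  from measurable_compose[OF this, of "\<lambda>(x, z). \<kappa> x z" borel] \<kappa>
  show "(\<lambda>\<omega>. \<kappa> (X t \<omega>) (Z t \<omega>)) \<in> H t \<rightarrow>\<^sub>M borel"
    by (simp add: minimizing_selector_def)
qed

text \<open>A reward depends on the control only through a point of a Euclidean space,
  hence countably many controls approximate the infimum.\<close>

lemma countable_controls: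
  obtains c :: "nat \<Rightarrow> 'u"
  where "\<And>j z e. 0 < e \<Longrightarrow> \<exists>n. reward j z (c n) < hamiltonian A B L (axis j 1) z + e"
proof -
  \<comment> \<open>These are the only data of a control that a reward sees. They lie in a separable
    metric space, and a countable dense part of the range lifts back to the controls
    \<open>D\<close>.\<close>
  define \<phi> where "\<phi> u = ((\<chi> j. L (axis j 1) u) :: real ^ 'n, B u)" for u
  define \<psi> where "\<psi> j z p = fst p $ j + (\<Sum>i\<in>UNIV. z $ i * (snd p $ i $ j - A $ i $ j))"
    for j and z and p :: "(real ^ 'n) \<times> (real ^ 'n ^ 'n)"
  have \<psi>\<phi>: "\<psi> j z (\<phi> u) = reward j z u" for j z u
    by (simp add: \<phi>_def \<psi>_def inner_transition_axis)
  obtain T where T: "countable T" "T \<subseteq> range \<phi>" "range \<phi> \<subseteq> closure T"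
    using separable[of "range \<phi>"] by blast
  then obtain D where D: "countable D" "T = \<phi> ` D"
    using countable_subset_image[of T \<phi> UNIV] by blast
  have "D \<noteq> {}" using D T by auto
  show ?thesis
  proof (rule that[of "from_nat_into D"])
    fix j z and e :: real assume "0 < e"
    let ?h = "hamiltonian A B L (axis j 1) z"
    have "\<exists>u. reward j z u < ?h + e"
    proof (rule ccontr)
      assume "\<not> ?thesis"
      then have "?h + e \<le> ?h"
        unfolding hamiltonian_def by (intro cINF_greatest) (auto simp: not_less)
      with \<open>0 < e\<close> show False by simp
    qed
    then obtain u where u: "reward j z u < ?h + e" by blast
    \<comment> \<open>Being within the tolerance is an open condition on the data, so it is also met
      at a point of the dense set.\<close>
    let ?O = "{p. \<psi> j z p < ?h + e}"
    have "open ?O"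
      unfolding \<psi>_def by (intro open_Collect_less continuous_intros)
    moreover have "\<phi> u \<in> ?O \<inter> closure T" using u T(3) by (auto simp: \<psi>\<phi>)
    ultimately have "?O \<inter> T \<noteq> {}"
      using open_Int_closure_eq_empty by blast
    then obtain v where "v \<in> D" "reward j z v < ?h + e" using D(2) by (auto simp: \<psi>\<phi>)
    moreover obtain n where "from_nat_into D n = v"
      using range_from_nat_into[OF \<open>D \<noteq> {}\<close> D(1)] \<open>v \<in> D\<close> by (metis imageE)
    ultimately show "\<exists>n. reward j z (from_nat_into D n) < ?h + e" by blast
  qed
qed

text \<open>The first of the countably many controls that is within the tolerance is chosen; its
  index is decided by countably many measurable tests. The tolerance depends on time so that the
  gaps can be made summable.\<close>

lemma near_optimal_control:
  assumes Z: "adapted M X Z" and e: "\<And>t. 0 < e t"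
  obtains U where "adapted M X U"
    "\<And>t \<omega>. \<omega> \<in> space M \<Longrightarrow> L (X t \<omega>) (U t \<omega>) + Z t \<omega> \<bullet> ((B (U t \<omega>) - A) *v X t \<omega>)
      < hamiltonian A B L (X t \<omega>) (Z t \<omega>) + e t"
proof -
  obtain c :: "nat \<Rightarrow> 'u" where c: "\<And>j z e. 0 < e \<Longrightarrow> \<exists>n. reward j z (c n) < hamiltonian A B L (axis j 1) z + e"
    by (rule countable_controls) blast
  let ?r = "\<lambda>t \<omega> u. L (X t \<omega>) u + Z t \<omega> \<bullet> ((B u - A) *v X t \<omega>)"
  define P where "P t n \<omega> \<longleftrightarrow> ?r t \<omega> (c n) < hamiltonian A B L (X t \<omega>) (Z t \<omega>) + e t" for t n \<omega>
  define U where "U = (\<lambda>t \<omega>. c (LEAST n. P t n \<omega>))"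
  have ZH: "Z t \<in> borel_measurable (H t)" for t using Z by (simp add: adapted_def)
  have "Measurable.pred (H t) (P t n)" for t n
  proof -
    have "(\<lambda>\<omega>. ?r t \<omega> (c n)) \<in> borel_measurable (H t)"
    proof (rule measurable_by_state[OF order_refl])
      show "(\<lambda>\<omega>. L (axis j 1) (c n) + Z t \<omega> \<bullet> ((B (c n) - A) *v axis j 1)) \<in> borel_measurable (H t)" for j
        using ZH by measurable
    qed simp
    moreover have "(\<lambda>\<omega>. hamiltonian A B L (X t \<omega>) (Z t \<omega>)) \<in> borel_measurable (H t)"
      by (rule hamiltonian_H[OF Z order_refl])
    ultimately show ?thesis unfolding P_def by measurable
  qed
  then have least: "(\<lambda>\<omega>. LEAST n. P t n \<omega>) \<in> H t \<rightarrow>\<^sub>M count_space UNIV" for t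
    by (rule measurable_Least)
  have "(\<lambda>\<omega>. c (LEAST n. P t n \<omega>)) \<in> H t \<rightarrow>\<^sub>M borel" for t
    by (rule measurable_compose[OF least]) simp
  then have "adapted M X U"
    by (simp add: adapted_def U_def)
  moreover have "?r t \<omega> (U t \<omega>) < hamiltonian A B L (X t \<omega>) (Z t \<omega>) + e t" if \<omega>: "\<omega> \<in> space M" for t \<omega>
  proof -
    obtain j where "X t \<omega> = axis j 1" using X_states[OF \<omega>, of t] by (rule statesE)
    then have "\<exists>n. P t n \<omega>" using c[OF e, of j "Z t \<omega>"] by (simp add: P_def)
    then have "P t (LEAST n. P t n \<omega>) \<omega>" by (rule LeastI_ex)
    then show ?thesis by (simp add: P_def U_def)
  qed
  ultimately show ?thesis by (rule that)
qed

section \<open>Optimal controls and uniqueness of the ergodic constant\<close>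

lemma controlled_processI:
  assumes "adapted M X U" "x \<in> states" "0 < prob {\<omega> \<in> space M. X 0 \<omega> = x}"
  shows "controlled_process M X A B L \<gamma> U x"
  by unfold_locales fact+

lemma optimal_control_exists:
  assumes sol: "ebsde_solution M X A (hamiltonian A B L) Y Z l" and "bounded_process M Y"
    and x: "x \<in> states" "0 < prob {\<omega> \<in> space M. X 0 \<omega> = x}"
  shows "\<exists>U. adapted M X U \<and> ergodic_cost M X B L x U = ereal l"
proof -
  have Z: "adapted M X Z" using sol by (simp add: ebsde_solution_def)
  obtain U where U: "adapted M X U"
    and near: "\<And>t \<omega>. \<omega> \<in> space M \<Longrightarrow> L (X t \<omega>) (U t \<omega>) + Z t \<omega> \<bullet> ((B (U t \<omega>) - A) *v X t \<omega>)
      < hamiltonian A B L (X t \<omega>) (Z t \<omega>) + (1 / 2) ^ t"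
    using near_optimal_control[OF Z, of "\<lambda>t. (1 / 2) ^ t"] by auto
  interpret controlled_process M X A B L \<gamma> U x
    by (rule controlled_processI[OF U x])
  have "ergodic_cost M X B L x U = ereal l"
  proof (rule ergodic_cost_eq[OF sol assms(2)])
    show "AE \<omega> in M. gap Z s \<omega> \<le> (1 / 2) ^ s" for s
      using near[of _ s] by (intro AE_I2) (simp add: gap_def less_imp_le diff_le_eq add.commute)
  qed
  with U show ?thesis by blast
qed

text \<open>A control optimal for one solution costs exactly its constant, and the lower bound from
  the other solution applies to the same cost. Exchanging the roles gives equality.\<close>

lemma ergodic_constant_unique:
  assumes "ebsde_solution M X A (hamiltonian A B L) Y Z l" "bounded_process M Y"
    and "ebsde_solution M X A (hamiltonian A B L) Y' Z' l'" "bounded_process M Y'"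
  shows "l = l'"
proof -
  \<comment> \<open>The comparison needs a starting state of positive mass; one exists because the
    sets \<open>ev 0 i\<close> cover the space.\<close>
  obtain i where i: "0 < prob (ev 0 i)"
  proof (rule ccontr)
    assume "\<not> thesis"
    then have "prob (ev 0 i) = 0" for i
      using that[of i] measure_nonneg[of M "ev 0 i"] by linarith
    moreover have "ev 0 i \<in> events" for i unfolding ev_def by measurable
    then have "range (ev 0) \<subseteq> events" by (rule image_subsetI)
    ultimately have "prob (\<Union>i. ev 0 i) \<le> 0"
      using finite_measure_subadditive_finite[of UNIV "ev 0"] by simp
    then show False by (simp add: UN_ev prob_space)
  qed
  then have x: "0 < prob {\<omega> \<in> space M. X 0 \<omega> = axis i 1}" by (simp add: ev_def)
  have le: "ereal l \<le> ereal l'"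
    if 1: "ebsde_solution M X A (hamiltonian A B L) Y Z l" "bounded_process M Y"
      and 2: "ebsde_solution M X A (hamiltonian A B L) Y' Z' l'" "bounded_process M Y'"
    for Y Z l Y' Z' l'
  proof -
    obtain U where ad: "adapted M X U" and cost: "ergodic_cost M X B L (axis i 1) U = ereal l'"
      using optimal_control_exists[OF 2 axis_in_states x] by blast
    interpret controlled_process M X A B L \<gamma> U "axis i 1"
      by (rule controlled_processI[OF ad axis_in_states x])
    show ?thesis using ergodic_cost_ge[OF 1] cost by simp
  qed
  show ?thesis using le[OF assms] le[OF assms(3,4,1,2)] by simp
qed

end

theorem theorem5p1:
  fixes M :: "'w measure"
    and X :: "nat \<Rightarrow> 'w \<Rightarrow> real ^ 'n"
    and A :: "real ^ 'n ^ 'n"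
    and B :: "'u::topological_space \<Rightarrow> real ^ 'n ^ 'n"
    and L :: "real ^ 'n \<Rightarrow> 'u \<Rightarrow> real"
    and \<gamma> :: real
  defines "f \<equiv> hamiltonian A B L"
  assumes "prob_space M"
    and "transition_matrix A"
    and "markov_chain M X A"
    and "uniformly_ergodic A"
    and "sets M = sigma_sets (space M) (\<Union>t. sets (history M X t))"
    and "\<exists>K :: nat \<Rightarrow> 'u set.
           (\<forall>n. compact (K n) \<and> metrizable_space (top_of_set (K n))) \<and> (\<Union>n. K n) = UNIV"
    and "continuous_on UNIV B"
    and "\<And>u. transition_matrix (B u)"
    and "0 < \<gamma>" and "\<gamma> < 1"
    and "\<And>u. gamma_equivalent \<gamma> (B u) A"
    and "bounded {L x u | x u. x \<in> states}"
    and "\<And>u. (\<lambda>x. L x u) \<in> restrict_space borel states \<rightarrow>\<^sub>M borel"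
    and "\<And>x. x \<in> states \<Longrightarrow> continuous_on UNIV (L x)"
  shows
    "(\<exists>Ybar Zbar lbar. ebsde_solution M X A f Ybar Zbar lbar \<and> bounded_process M Ybar \<and>
        stationary_markovian M X Ybar Zbar) \<and>
     (\<forall>Ybar Zbar lbar Y Z l.
        ebsde_solution M X A f Ybar Zbar lbar \<and> bounded_process M Ybar \<and>
        stationary_markovian M X Ybar Zbar \<and>
        ebsde_solution M X A f Y Z l \<and> bounded_process M Y \<longrightarrow>
        l = lbar \<and>
        (\<forall>x\<in>states. 0 < measure M {\<omega> \<in> space M. X 0 \<omega> = x} \<longrightarrow>
          (\<forall>U. adapted M X U \<longrightarrow>
             ereal l \<le> ergodic_cost M X B L x U \<and>
             ((AE \<omega> in M. \<forall>s. f (X s \<omega>) (Z s \<omega>) =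
                  L (X s \<omega>) (U s \<omega>) + Z s \<omega> \<bullet> ((B (U s \<omega>) - A) *v X s \<omega>)) \<longrightarrow>
              ergodic_cost M X B L x U = ereal l)) \<and>
          ((\<forall>x'\<in>states. \<forall>z. \<exists>u. f x' z = L x' u + z \<bullet> ((B u - A) *v x')) \<longrightarrow>
             (\<exists>\<kappa>. minimizing_selector A B L \<kappa>) \<and>
             (\<forall>\<kappa>. minimizing_selector A B L \<kappa> \<longrightarrow>
                adapted M X (\<lambda>t \<omega>. \<kappa> (X t \<omega>) (Z t \<omega>)) \<and>
                ergodic_cost M X B L x (\<lambda>t \<omega>. \<kappa> (X t \<omega>) (Z t \<omega>)) = ereal lbar)) \<and>
          (\<exists>U. adapted M X U \<and> ergodic_cost M X B L x U = ereal lbar)))"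
proof -
  interpret controlled_chain M X A B L \<gamma>
  proof (intro controlled_chain.intro finite_chain.intro)
    show "finite_chain_axioms M X A" by unfold_locales fact+
    show "control_data A B L \<gamma>" by unfold_locales (use assms in simp_all)
    show "controlled_chain_axioms B L" by unfold_locales fact+
  qed fact
  obtain K :: "nat \<Rightarrow> 'u set" where K: "\<And>n. compact (K n)" "\<And>n. metrizable_space (top_of_set (K n))"
    "(\<Union>n. K n) = UNIV"
    using assms(7) by blast
  show ?thesis
  proof (intro conjI allI impI ballI; (elim conjE)?)
    show "\<exists>Ybar Zbar lbar. ebsde_solution M X A f Ybar Zbar lbar \<and> bounded_process M Ybar \<and>
        stationary_markovian M X Ybar Zbar"
      unfolding f_def by (rule ebsde_solution_exists[OF assms(5)])
  next
    fix Ybar Zbar lbar Y Z l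
    assume "ebsde_solution M X A f Ybar Zbar lbar" "bounded_process M Ybar"
      and sol: "ebsde_solution M X A f Y Z l" "bounded_process M Y"
    then show l: "l = lbar"
      unfolding f_def using ergodic_constant_unique by blast
    note sol = sol[unfolded f_def]
    have Z: "adapted M X Z" using sol by (simp add: ebsde_solution_def)
    fix x assume x: "x \<in> states" "0 < prob {\<omega> \<in> space M. X 0 \<omega> = x}"
    show "\<exists>U. adapted M X U \<and> ergodic_cost M X B L x U = ereal lbar"
      using optimal_control_exists[OF sol x] l by simp
    \<comment> \<open>The locale fixes one control, so it is interpreted for an arbitrary
      \<open>U\<close> and its conclusions are exported.\<close>
    have lower: "ereal l \<le> ergodic_cost M X B L x U"
      and optimal: "(AE \<omega> in M. \<forall>s. f (X s \<omega>) (Z s \<omega>) =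
          L (X s \<omega>) (U s \<omega>) + Z s \<omega> \<bullet> ((B (U s \<omega>) - A) *v X s \<omega>)) \<Longrightarrow>
        ergodic_cost M X B L x U = ereal l"
      if "adapted M X U" for U :: "nat \<Rightarrow> 'w \<Rightarrow> 'u"
    proof -
      interpret controlled_process M X A B L \<gamma> U x by (rule controlled_processI[OF that x])
      show "ereal l \<le> ergodic_cost M X B L x U" by (rule ergodic_cost_ge[OF sol])
      show "ergodic_cost M X B L x U = ereal l"
        if "AE \<omega> in M. \<forall>s. f (X s \<omega>) (Z s \<omega>) =
          L (X s \<omega>) (U s \<omega>) + Z s \<omega> \<bullet> ((B (U s \<omega>) - A) *v X s \<omega>)"
        using ergodic_cost_eq_optimal[OF sol] that by (simp add: f_def)
    qed
    show "ereal l \<le> ergodic_cost M X B L x U" if "adapted M X U" for U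
      by (rule lower[OF that])
    show "ergodic_cost M X B L x U = ereal l"
      if "adapted M X U" "AE \<omega> in M. \<forall>s. f (X s \<omega>) (Z s \<omega>) =
        L (X s \<omega>) (U s \<omega>) + Z s \<omega> \<bullet> ((B (U s \<omega>) - A) *v X s \<omega>)" for U
      by (rule optimal[OF that])
    show "\<exists>\<kappa>. minimizing_selector A B L \<kappa>"
      if "\<forall>x'\<in>states. \<forall>z. \<exists>u. f x' z = L x' u + z \<bullet> ((B u - A) *v x')"
      using minimizing_selector_exists[OF K] that by (simp add: f_def)
    fix \<kappa> assume \<kappa>: "minimizing_selector A B L \<kappa>"
    show ad: "adapted M X (\<lambda>t \<omega>. \<kappa> (X t \<omega>) (Z t \<omega>))"
      by (rule minimizing_selector_adapted[OF \<kappa> Z])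
    show "ergodic_cost M X B L x (\<lambda>t \<omega>. \<kappa> (X t \<omega>) (Z t \<omega>)) = ereal lbar"
      unfolding l[symmetric]
    proof (rule optimal[OF ad])
      show "AE \<omega> in M. \<forall>s. f (X s \<omega>) (Z s \<omega>) = L (X s \<omega>) (\<kappa> (X s \<omega>) (Z s \<omega>))
          + Z s \<omega> \<bullet> ((B (\<kappa> (X s \<omega>) (Z s \<omega>)) - A) *v X s \<omega>)"
        using \<kappa> X_states by (intro AE_I2 allI) (simp add: minimizing_selector_def f_def)
    qed
  qed
qed

end
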